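(* Let $0<\epsilon<\frac12$ and define $\delta=\delta(\epsilon):=\epsilon\,2^{-\frac1\epsilon}$. Then $$Q(x)=\sum_{1\le n<x^{\epsilon}}\frac1n\sin\left(\frac xn\right)+\frac\pi2+O_\epsilon\left(x^{-\delta}\right),$$ that is, there is a constant $C>0$ depending only on $\epsilon$ such that for all real $x\ge1$, $$\left|Q(x)-\sum_{1\le n<x^{\epsilon}}\frac1n\sin\left(\frac xn\right)-\frac\pi2\right|\le C\,x^{-\delta}.$$ Here $n$ ranges over integers.
   Context: The Hardy-Littlewood function is $Q(x):=\sum_{n\ge1}\frac1n\sin\left(\frac xn\right)$. An empty sum equals $0$. *)

theory Defs
  imports "HOL-Analysis.Analysis"
begin

definition hardy_littlewood_Q :: "real \<Rightarrow> real" where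
  "hardy_littlewood_Q x = (\<Sum>n. 1 / real (Suc n) * sin (x / real (Suc n)))"

lemma summable_hardy_littlewood_Q:
  "summable (\<lambda>n. 1 / real (Suc n) * sin (x / real (Suc n)))"
proof (rule summable_comparison_test')
  have "summable (\<lambda>n. inverse (real (Suc n) ^ 2))"
    using inverse_power_summable[of 2, where ?'a = real] by (subst summable_Suc_iff) simp
  then show "summable (\<lambda>n. \<bar>x\<bar> * inverse (real (Suc n) ^ 2))"
    by (rule summable_mult)
next
  fix n :: nat
  have "norm (1 / real (Suc n) * sin (x / real (Suc n)))
      = 1 / real (Suc n) * \<bar>sin (x / real (Suc n))\<bar>"
    by (simp add: abs_mult)
  also have "\<dots> \<le> 1 / real (Suc n) * \<bar>x / real (Suc n)\<bar>"
    by (intro mult_left_mono abs_sin_x_le_abs_x) simp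
  also have "\<dots> = \<bar>x\<bar> * inverse (real (Suc n) ^ 2)"
    by (simp add: field_simps power2_eq_square)
  finally show "norm (1 / real (Suc n) * sin (x / real (Suc n)))
      \<le> \<bar>x\<bar> * inverse (real (Suc n) ^ 2)" .
qed

definition hl_delta :: "real \<Rightarrow> real" where
  "hl_delta \<epsilon> = \<epsilon> * 2 powr (- (1 / \<epsilon>))"

end

theory Submission
  imports Defs "HOL-Probability.Sinc_Integral"
begin

text \<open>
  For \<open>n \<ge> x\<^bsup>2/3\<^esup>\<close> the terms vary slowly, so the sum is close to
  \<open>\<integral> sin (x/t) / t dt = Si (x\<^bsup>1/3\<^esup>)\<close>, which is \<open>\<pi>/2\<close> up to a power of \<open>x\<close>.
  The terms \<open>x\<^bsup>\<epsilon>\<^esup> \<le> n < x\<^bsup>2/3\<^esup>\<close> cancel: on a dyadic block starting at \<open>N = x\<^bsup>\<theta>\<^esup>\<close> van der Corput's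
  estimate of order \<open>k\<close> applies to the phase \<open>x / n\<close>, whose \<open>k\<close>-th difference has size
  \<open>x / N\<^bsup>k+1\<^esup>\<close>. For a suitable \<open>k\<close> near \<open>1/\<theta>\<close> it saves strictly more than
  \<open>x\<^bsup>\<delta>\<^esup>\<close> with \<open>\<delta> = \<theta> 2\<^bsup>-1/\<theta>\<^esup>\<close>, which also absorbs the number of blocks. Finite differences
  take the place of derivatives throughout; this makes van der Corput's induction, which replaces
  \<open>f\<close> by \<open>f (n + t) - f n\<close>, and the phase \<open>x / n\<close> explicit.
\<close>

section \<open>Elementary inequalities\<close>

lemma powr_Bernoulli_le:
  fixes x u :: real
  assumes "- 1 \<le> x" "0 \<le> u" "u \<le> 1"
  shows "(1 + x) powr u \<le> 1 + u * x"
proof (cases "x = - 1")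
  case False
  then have "(1 + x) powr u * 1 powr (1 - u) \<le> u * (1 + x) + (1 - u) * 1"
    using assms by (intro Youngs_inequality_0) auto
  then show ?thesis by (simp add: algebra_simps)
qed (use assms in simp)

lemma sum_powr_minus_le:
  assumes "0 \<le> E" "E < 1"
  shows "(\<Sum>t=1..q. real t powr (- E)) \<le> real q powr (1 - E) / (1 - E)"
proof (induction q)
  case (Suc q)
  define p where "p = real (Suc q)"
  have p_ge_1: "1 \<le> p" and q_eq: "real q = p * (1 + - (1 / p))" by (simp_all add: p_def field_simps)
  have "real q powr (1 - E) = p powr (1 - E) * (1 + - (1 / p)) powr (1 - E)"
    using p_ge_1 unfolding q_eq by (subst powr_mult) auto
  also have "\<dots> \<le> p powr (1 - E) * (1 + (1 - E) * - (1 / p))"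
    using assms p_ge_1 by (intro mult_left_mono powr_Bernoulli_le) auto
  also have "\<dots> = p powr (1 - E) - (1 - E) * (p powr (1 - E) / p powr 1)"
    using p_ge_1 by (simp add: algebra_simps)
  also have "p powr (1 - E) / p powr 1 = p powr (- E)"
    by (simp only: powr_diff[symmetric]) simp
  finally have "(real q powr (1 - E) + (1 - E) * p powr (- E)) / (1 - E) \<le> p powr (1 - E) / (1 - E)"
    using assms by (intro divide_right_mono) auto
  then show ?case using Suc assms by (simp add: p_def add_divide_distrib)
qed simp

lemma power_le_pochhammer:
  fixes a :: "'a::linordered_semidom"
  assumes "0 \<le> a"
  shows "a ^ n \<le> pochhammer a n"
proof -
  have "(\<Prod>i<n. a) \<le> (\<Prod>i<n. a + of_nat i)"
    using assms by (intro prod_mono) auto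
  then show ?thesis by (simp add: pochhammer_prod lessThan_atLeast0)
qed

lemma pochhammer_le_power:
  fixes a :: "'a::linordered_semidom"
  assumes "0 \<le> a"
  shows "pochhammer a n \<le> (a + of_nat n) ^ n"
proof -
  have "(\<Prod>i<n. a + of_nat i) \<le> (\<Prod>i<n. a + of_nat n)"
    using assms by (intro prod_mono) auto
  then show ?thesis by (simp add: pochhammer_prod lessThan_atLeast0)
qed

lemma abel_inequality:
  fixes z :: "nat \<Rightarrow> 'a::real_normed_vector"
  assumes "p < q"
    and anti: "antimono_on {p..<q} a" and nonneg: "\<And>n. n \<in> {p..<q} \<Longrightarrow> 0 \<le> a n"
    and partial: "\<And>k. k \<in> {p..q} \<Longrightarrow> norm (\<Sum>n=p..<k. z n) \<le> T"
  shows "norm (\<Sum>n=p..<q. a n *\<^sub>R z n) \<le> a p * T"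
proof -
  obtain r where r: "q = Suc r" "p \<le> r" using \<open>p < q\<close> by (cases q) auto
  have by_parts: "(\<Sum>n=p..<Suc k. a n *\<^sub>R z n) = a k *\<^sub>R (\<Sum>n=p..<Suc k. z n)
      + (\<Sum>n=p..<k. (a n - a (Suc n)) *\<^sub>R (\<Sum>i=p..<Suc n. z i))" if "p \<le> k" for k
    using that by (induction k rule: dec_induct) (simp_all add: algebra_simps)
  have decr: "a (Suc n) \<le> a n" if "n \<in> {p..<r}" for n
    using anti that r by (auto simp: monotone_on_def)
  have "norm (\<Sum>n=p..<r. (a n - a (Suc n)) *\<^sub>R (\<Sum>i=p..<Suc n. z i))
      \<le> (\<Sum>n=p..<r. (a n - a (Suc n)) * T)"
  proof (intro sum_norm_le)
    fix n assume n: "n \<in> {p..<r}"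
    then have "norm (\<Sum>i=p..<Suc n. z i) \<le> T" using r by (intro partial) auto
    then show "norm ((a n - a (Suc n)) *\<^sub>R (\<Sum>i=p..<Suc n. z i)) \<le> (a n - a (Suc n)) * T"
      using decr[OF n] by (simp add: mult_left_mono)
  qed
  also have "\<dots> = (a p - a r) * T"
    using sum_Suc_diff'[OF \<open>p \<le> r\<close>, of "\<lambda>n. - a n"] by (simp add: sum_distrib_right[symmetric])
  finally have differences: "norm (\<Sum>n=p..<r. (a n - a (Suc n)) *\<^sub>R (\<Sum>i=p..<Suc n. z i))
      \<le> (a p - a r) * T" .
  have "norm (a r *\<^sub>R (\<Sum>n=p..<q. z n)) \<le> a r * T"
    using nonneg[of r] partial[of q] r by (simp add: mult_left_mono)
  then have "norm (\<Sum>n=p..<q. a n *\<^sub>R z n) \<le> a r * T + (a p - a r) * T"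
    unfolding r(1) by_parts[OF \<open>p \<le> r\<close>] using differences by (rule norm_triangle_mono)
  then show ?thesis by (simp add: algebra_simps)
qed

lemma four_le_two_power: "2 \<le> k \<Longrightarrow> (4::real) \<le> 2 ^ k"
  using power_increasing[of 2 k "2::real"] by simp

section \<open>The Kusmin--Landau inequality\<close>

definition forward_diff :: "(nat \<Rightarrow> 'a::ab_group_add) \<Rightarrow> nat \<Rightarrow> 'a" where
  "forward_diff f n = f (Suc n) - f n"

abbreviation cis2pi :: "real \<Rightarrow> complex" where
  "cis2pi t \<equiv> cis (2 * pi * t)"

lemma norm_sum_cis_le: "norm (\<Sum>n\<in>X. cis (f n)) \<le> real (card X)"
  using sum_norm_le[of X "\<lambda>n. cis (f n)" "\<lambda>_. 1"] by simp

lemma concave_on_sin: "concave_on {0..pi} sin"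
proof (rule f''_le0_imp_concave)
  show "(sin has_real_derivative cos x) (at x)" for x :: real by (rule DERIV_sin)
  show "(cos has_real_derivative - sin x) (at x)" for x :: real by (rule DERIV_cos)
  show "- sin x \<le> 0" if "x \<in> {0..pi}" for x :: real using that by (simp add: sin_ge_zero)
qed simp

lemma Jordan_inequality:
  fixes x :: real
  assumes "0 \<le> x" "x \<le> pi / 2"
  shows "2 / pi * x \<le> sin x"
proof -
  have "2 / pi * x \<le> 1" using assms by (simp add: divide_le_eq)
  then show ?thesis
    using concave_onD[OF concave_on_sin, of "2 / pi * x" 0 "pi / 2"] assms by simp
qed

lemma sin_pi_ge:
  fixes s t :: real
  assumes "0 \<le> s" "s \<le> t" "t \<le> 1 - s"
  shows "2 * s \<le> sin (pi * t)"
proof -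
  have "2 * s \<le> sin (pi * s)"
    using Jordan_inequality[of "pi * s"] assms by simp
  also have "\<dots> = min (sin (pi * s)) (sin (pi * (1 - s)))"
    by (simp add: right_diff_distrib)
  also have "\<dots> \<le> sin (pi * t)"
  proof (rule concave_on_ge_min[where f = sin])
    have "{pi * s..pi * (1 - s)} \<subseteq> {0..pi}"
      using assms by (auto simp: mult_left_le intro: order_trans)
    then show "concave_on {pi * s..pi * (1 - s)} sin"
      using concave_on_sin convex_on_subset convex_real_interval(5) unfolding concave_on_def by blast
    show "pi * t \<in> {pi * s..pi * (1 - s)}" using assms by simp
  qed
  finally show ?thesis .
qed

lemma antimono_on_cot: "antimono_on {0<..<pi} (cot :: real \<Rightarrow> real)"
proof (rule monotone_onI)
  fix a b :: real
  assume ab: "a \<in> {0<..<pi}" "b \<in> {0<..<pi}" "a \<le> b"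
  then have "0 < sin a" "0 < sin b" "0 \<le> sin (b - a)"
    by (auto intro: sin_gt_zero sin_ge_zero)
  moreover from this have "cot a - cot b = sin (b - a) / (sin a * sin b)"
    by (simp add: cot_def sin_diff field_simps)
  ultimately show "cot a \<ge> cot b"
    by (metis diff_ge_0_iff_ge divide_nonneg_pos mult_pos_pos)
qed

lemma two_cis2pi_eq_Complex_cot_mult:
  fixes m :: int
  assumes "sin (pi * (u - t - of_int m)) \<noteq> 0"
  shows "2 * cis2pi t = Complex 1 (cot (pi * (u - t - of_int m))) * (cis2pi t - cis2pi u)"
proof -
  define a where "a = pi * (u - t - of_int m)"
  have "cis2pi t * cis (2 * a) = cis (2 * pi * u - 2 * pi * of_int m)"
    by (simp add: cis_mult a_def algebra_simps)
  also have "\<dots> = cis2pi u"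
    by (metis cis_divide cis_multiple_2pi Ints_of_int div_by_1)
  finally have cis2pi_u: "cis2pi u = cis2pi t * cis (2 * a)" by simp
  have "cos a * cos a = 1 - sin a * sin a"
    using sin_cos_squared_add[of a] by (simp add: power2_eq_square)
  then have "2 = Complex 1 (cot a) * (1 - cis (2 * a))"
    using assms
    by (simp add: complex_eq_iff cot_def cos_double_sin sin_double power2_eq_square flip: a_def)
  then have "2 * cis2pi t = Complex 1 (cot a) * (1 - cis (2 * a)) * cis2pi t" by simp
  then show ?thesis unfolding cis2pi_u by (simp add: a_def algebra_simps)
qed

lemma norm_Complex_cot:
  assumes "0 < sin a"
  shows "norm (Complex 1 (cot a)) = 1 / sin a"
proof -
  have "(norm (Complex 1 (cot a)))\<^sup>2 = (1 / sin a)\<^sup>2"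
    using assms sin_cos_squared_add[of a] by (simp add: cmod_power2 cot_def power_divide field_simps)
  then show ?thesis using assms by (simp add: power2_eq_iff_nonneg)
qed

lemma norm_sum_Complex_mult_diff_le:
  fixes c :: "nat \<Rightarrow> real" and w :: "nat \<Rightarrow> complex"
  assumes "p \<le> r" and anti: "antimono_on {p..r} c" and unit: "\<And>n. norm (w n) \<le> 1"
  shows "norm (\<Sum>n=p..r. Complex 1 (c n) * (w n - w (Suc n)))
    \<le> 2 * norm (Complex 1 (c r)) + 2 * (c p - c r)"
proof -
  have telescope: "norm (\<Sum>n=p..<k. w n - w (Suc n)) \<le> 2" if "p \<le> k" for k
  proof -
    have "(\<Sum>n=p..<k. w n - w (Suc n)) = w p - w k"
      using sum_Suc_diff'[OF that, of "\<lambda>n. - w n"] by simp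
    then show ?thesis
      using norm_triangle_ineq4[of "w p" "w k"] unit[of p] unit[of k] by simp
  qed
  have r: "r \<in> {p..<Suc r}" using \<open>p \<le> r\<close> by simp
  have anti: "antimono_on {p..<Suc r} c"
    using anti by (simp add: atLeastLessThanSuc_atLeastAtMost)
  define S V where "S = (\<Sum>n=p..<Suc r. w n - w (Suc n))"
    and "V = (\<Sum>n=p..<Suc r. (c n - c r) *\<^sub>R (w n - w (Suc n)))"
  have "norm V \<le> (c p - c r) * 2"
    unfolding V_def
  proof (rule abel_inequality)
    show "antimono_on {p..<Suc r} (\<lambda>n. c n - c r)"
      using anti by (simp add: monotone_on_def)
    show "0 \<le> c n - c r" if "n \<in> {p..<Suc r}" for n
      using monotone_onD[OF anti that r] that by simp
  qed (use telescope \<open>p \<le> r\<close> in auto)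
  moreover have "norm (Complex 1 (c r) * S) \<le> norm (Complex 1 (c r)) * 2"
    unfolding norm_mult S_def using \<open>p \<le> r\<close> by (intro mult_left_mono telescope) auto
  moreover have "(\<Sum>n=p..r. Complex 1 (c n) * (w n - w (Suc n))) = Complex 1 (c r) * S + \<i> * V"
  proof -
    have "(\<Sum>n=p..r. Complex 1 (c n) * (w n - w (Suc n)))
        = (\<Sum>n=p..r. Complex 1 (c r) * (w n - w (Suc n)) + \<i> * ((c n - c r) *\<^sub>R (w n - w (Suc n))))"
      by (intro sum.cong refl) (simp add: complex_eq_iff algebra_simps)
    then show ?thesis
      by (simp only: S_def V_def sum.distrib sum_distrib_left atLeastLessThanSuc_atLeastAtMost)
  qed
  ultimately show ?thesis
    using norm_triangle_ineq[of "Complex 1 (c r) * S" "\<i> * V"] by (simp add: norm_mult)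
qed

theorem kusmin_landau:
  fixes f :: "nat \<Rightarrow> real" and m :: int
  assumes s: "0 < s" and mono: "mono_on {p..<q} (forward_diff f)"
    and range: "\<And>n. n \<in> {p..<q} \<Longrightarrow> forward_diff f n \<in> {of_int m + s..of_int m + 1 - s}"
  shows "norm (\<Sum>n=p..<q. cis2pi (f n)) \<le> 3 / (2 * s)"
proof (cases "p < q")
  case True
  then obtain r where r: "q = Suc r" "p \<le> r" by (cases q) auto
  then have interval: "{p..<q} = {p..r}" by (simp add: atLeastLessThanSuc_atLeastAtMost)
  define angle where "angle n = pi * (f (Suc n) - f n - of_int m)" for n
  have sin_angle: "2 * s \<le> sin (angle n)" if "n \<in> {p..r}" for n
    unfolding angle_def using range[of n] that interval s
    by (intro sin_pi_ge) (auto simp: forward_diff_def)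
  have norm_cot: "norm (Complex 1 (cot (angle n))) \<le> 1 / (2 * s)" if "n \<in> {p..r}" for n
    using sin_angle[OF that] s by (simp add: norm_Complex_cot divide_left_mono)
  have "antimono_on {p..r} (\<lambda>n. cot (angle n))"
  proof (rule monotone_onI)
    fix i j assume ij: "i \<in> {p..r}" "j \<in> {p..r}" "i \<le> j"
    have "angle n \<in> {0<..<pi}" if "n \<in> {p..r}" for n
      using range[of n] that interval s by (auto simp: angle_def forward_diff_def)
    moreover have "angle i \<le> angle j"
      using monotone_onD[OF mono[unfolded interval] ij] by (simp add: angle_def forward_diff_def)
    ultimately show "cot (angle i) \<ge> cot (angle j)"
      using ij by (intro monotone_onD[OF antimono_on_cot]) auto
  qed
  then have "norm (\<Sum>n=p..r. Complex 1 (cot (angle n)) * (cis2pi (f n) - cis2pi (f (Suc n))))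
      \<le> 2 * norm (Complex 1 (cot (angle r))) + 2 * (cot (angle p) - cot (angle r))"
    by (intro norm_sum_Complex_mult_diff_le r) auto
  also have "\<dots> \<le> 2 * (1 / (2 * s)) + 2 * (1 / (2 * s) + 1 / (2 * s))"
  proof -
    have "\<bar>cot (angle n)\<bar> \<le> 1 / (2 * s)" if "n \<in> {p..r}" for n
      using norm_cot[OF that] abs_Im_le_cmod[of "Complex 1 (cot (angle n))"] by simp
    from this[of p] this[of r] norm_cot[of r] show ?thesis
      using r(2) by (intro add_mono mult_left_mono) (auto simp: abs_le_iff)
  qed
  also have "(\<Sum>n=p..r. Complex 1 (cot (angle n)) * (cis2pi (f n) - cis2pi (f (Suc n))))
      = 2 * (\<Sum>n=p..r. cis2pi (f n))"
    unfolding sum_distrib_left angle_def using sin_angle s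
    by (intro sum.cong refl two_cis2pi_eq_Complex_cot_mult[symmetric])
      (force simp: angle_def)
  finally show ?thesis by (simp add: interval norm_mult)
qed (use s in simp)

section \<open>The second difference test\<close>

lemma finite_convex_nat_eq_atLeastLessThan:
  fixes X :: "nat set"
  assumes "finite X" and convex: "\<And>i j k. i \<in> X \<Longrightarrow> k \<in> X \<Longrightarrow> i \<le> j \<Longrightarrow> j \<le> k \<Longrightarrow> j \<in> X"
  shows "\<exists>p q. X = {p..<q}"
proof (cases "X = {}")
  case False
  then have "{Min X..<Suc (Max X)} \<subseteq> X"
    using \<open>finite X\<close> convex[OF Min_in Max_in] by (auto simp: less_Suc_eq_le)
  moreover have "X \<subseteq> {Min X..<Suc (Max X)}"
    using \<open>finite X\<close> by (auto simp: less_Suc_eq_le)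
  ultimately show ?thesis by blast
qed auto

lemma mono_on_atMost_SucI:
  fixes g :: "nat \<Rightarrow> 'a::order"
  assumes "\<And>n. n < L \<Longrightarrow> g n \<le> g (Suc n)"
  shows "mono_on {..L} g"
proof (rule monotone_onI)
  fix i j assume "i \<in> {..L}" "j \<in> {..L}" "i \<le> j"
  from \<open>i \<le> j\<close> \<open>j \<in> {..L}\<close> show "g i \<le> g j"
  proof (induction j rule: dec_induct)
    case (step n)
    then show ?case using assms[of n] by (auto intro: order_trans)
  qed simp
qed

lemma mono_on_of_expanding:
  fixes d :: "nat \<Rightarrow> real"
  assumes "0 \<le> \<mu>" and expanding: "mono_on X (\<lambda>n. d n - \<mu> * real n)"
  shows "mono_on X d"
proof (rule monotone_onI)
  fix i j assume ij: "i \<in> X" "j \<in> X" "i \<le> j"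
  then have "\<mu> * real i \<le> \<mu> * real j" using \<open>0 \<le> \<mu>\<close> by (simp add: mult_left_mono)
  then show "d i \<le> d j" using monotone_onD[OF expanding ij] by linarith
qed

lemma card_le_of_expanding:
  fixes d :: "nat \<Rightarrow> real"
  assumes "finite X" "0 < \<mu>" "0 \<le> w"
    and expanding: "mono_on X (\<lambda>n. d n - \<mu> * real n)"
    and range: "\<And>n. n \<in> X \<Longrightarrow> d n \<in> {u..u + w}"
  shows "real (card X) \<le> w / \<mu> + 1"
proof (cases "X = {}")
  case False
  then have ends: "Min X \<in> X" "Max X \<in> X" "Min X \<le> Max X" using \<open>finite X\<close> by auto
  have "X \<subseteq> {Min X..Max X}" using \<open>finite X\<close> by auto
  then have "card X \<le> card {Min X..Max X}" by (intro card_mono) auto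
  then have "real (card X) \<le> real (Max X) - real (Min X) + 1" using ends by simp
  also have "\<mu> * (real (Max X) - real (Min X)) \<le> w"
    using monotone_onD[OF expanding ends] range[OF ends(1)] range[OF ends(2)]
    by (simp add: algebra_simps)
  then have "real (Max X) - real (Min X) \<le> w / \<mu>"
    using \<open>0 < \<mu>\<close> by (simp add: pos_le_divide_eq mult.commute)
  finally show ?thesis by simp
qed (use assms in simp)

lemma kusmin_landau_level_set:
  fixes f :: "nat \<Rightarrow> real" and m :: int
  assumes "0 < s" and mono: "mono_on {..<L} (forward_diff f)"
  shows "norm (\<Sum>n\<in>{n \<in> {..<L}. forward_diff f n \<in> {of_int m + s..of_int m + 1 - s}}. cis2pi (f n))
    \<le> 3 / (2 * s)"
proof -
  define X where "X = {n \<in> {..<L}. forward_diff f n \<in> {of_int m + s..of_int m + 1 - s}}"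
  have "\<exists>p q. X = {p..<q}"
  proof (rule finite_convex_nat_eq_atLeastLessThan)
    fix i j k assume "i \<in> X" "k \<in> X" "i \<le> j" "j \<le> k"
    then show "j \<in> X"
      using monotone_onD[OF mono, of i j] monotone_onD[OF mono, of j k] by (auto simp: X_def)
  qed (simp add: X_def)
  then obtain p q where interval: "X = {p..<q}" by blast
  have "norm (\<Sum>n=p..<q. cis2pi (f n)) \<le> 3 / (2 * s)"
  proof (rule kusmin_landau[OF \<open>0 < s\<close>])
    show "mono_on {p..<q} (forward_diff f)"
      unfolding interval[symmetric] using mono by (rule monotone_on_subset) (auto simp: X_def)
    show "forward_diff f n \<in> {of_int m + s..of_int m + 1 - s}" if "n \<in> {p..<q}" for n
      using that unfolding interval[symmetric] by (simp add: X_def)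
  qed
  then show ?thesis unfolding interval[symmetric] by (simp only: X_def)
qed

text \<open>Near the ends of the unit interval the terms are counted; in between Kusmin--Landau applies.\<close>

lemma norm_sum_cis2pi_floor_eq_le:
  fixes f :: "nat \<Rightarrow> real" and m :: int
  assumes "0 < \<mu>" "0 < s" "s \<le> 1 / 2"
    and expanding: "mono_on {..<L} (\<lambda>n. forward_diff f n - \<mu> * real n)"
  shows "norm (\<Sum>n\<in>{n \<in> {..<L}. \<lfloor>forward_diff f n\<rfloor> = m}. cis2pi (f n))
    \<le> 2 * (s / \<mu> + 1) + 3 / (2 * s)"
proof -
  let ?d = "forward_diff f"
  define lower where "lower = {n \<in> {..<L}. of_int m \<le> ?d n \<and> ?d n < of_int m + s}"
  define middle where "middle = {n \<in> {..<L}. ?d n \<in> {of_int m + s..of_int m + 1 - s}}"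
  define upper where "upper = {n \<in> {..<L}. of_int m + 1 - s < ?d n \<and> ?d n < of_int m + 1}"
  have counted: "norm (\<Sum>n\<in>X. cis2pi (f n)) \<le> s / \<mu> + 1"
    if "X \<subseteq> {..<L}" "\<And>n. n \<in> X \<Longrightarrow> ?d n \<in> {u..u + s}" for X u
  proof -
    have "real (card X) \<le> s / \<mu> + 1"
      using that finite_subset[OF that(1)] monotone_on_subset[OF expanding that(1)] assms(1,2)
      by (intro card_le_of_expanding[where d = ?d and u = u]) auto
    then show ?thesis by (rule order_trans[OF norm_sum_cis_le])
  qed
  have "norm (\<Sum>n\<in>lower. cis2pi (f n)) \<le> s / \<mu> + 1"
    by (rule counted[of _ "of_int m"]) (auto simp: lower_def)
  moreover have "norm (\<Sum>n\<in>middle. cis2pi (f n)) \<le> 3 / (2 * s)"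
    unfolding middle_def
    using assms(1)
    by (intro kusmin_landau_level_set mono_on_of_expanding[OF _ expanding] assms(2)) simp
  moreover have "norm (\<Sum>n\<in>upper. cis2pi (f n)) \<le> s / \<mu> + 1"
    by (rule counted[of _ "of_int m + 1 - s"]) (auto simp: upper_def)
  ultimately have "norm ((\<Sum>n\<in>lower. cis2pi (f n)) + (\<Sum>n\<in>middle. cis2pi (f n))
      + (\<Sum>n\<in>upper. cis2pi (f n))) \<le> (s / \<mu> + 1) + 3 / (2 * s) + (s / \<mu> + 1)"
    by (intro norm_triangle_mono)
  moreover have "{n \<in> {..<L}. \<lfloor>?d n\<rfloor> = m} = lower \<union> middle \<union> upper"
    using assms by (auto simp: lower_def middle_def upper_def floor_eq_iff)
  moreover have "lower \<inter> middle = {}" "(lower \<union> middle) \<inter> upper = {}"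
    using assms by (auto simp: lower_def middle_def upper_def)
  moreover have "finite lower" "finite middle" "finite upper"
    by (auto simp: lower_def middle_def upper_def)
  ultimately show ?thesis by (simp add: sum.union_disjoint)
qed

lemma card_floor_image_le:
  fixes d :: "nat \<Rightarrow> real"
  assumes "mono_on {..L} d"
  shows "real (card ((\<lambda>n. \<lfloor>d n\<rfloor>) ` {..L})) \<le> d L - d 0 + 2"
proof -
  have "(\<lambda>n. \<lfloor>d n\<rfloor>) ` {..L} \<subseteq> {\<lfloor>d 0\<rfloor>..\<lfloor>d L\<rfloor>}"
    using assms by (auto intro!: floor_mono dest: monotone_onD)
  then have "card ((\<lambda>n. \<lfloor>d n\<rfloor>) ` {..L}) \<le> card {\<lfloor>d 0\<rfloor>..\<lfloor>d L\<rfloor>}" by (intro card_mono) auto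
  moreover have "\<lfloor>d 0\<rfloor> \<le> \<lfloor>d L\<rfloor>" using monotone_onD[OF assms, of 0 L] by (simp add: floor_mono)
  ultimately show ?thesis by simp linarith
qed

lemma norm_sum_cis2pi_le_of_expanding:
  fixes f :: "nat \<Rightarrow> real"
  assumes "0 < \<mu>" "0 < s" "s \<le> 1 / 2"
    and expanding: "mono_on {..L} (\<lambda>n. forward_diff f n - \<mu> * real n)"
  shows "norm (\<Sum>n<L. cis2pi (f n))
    \<le> (forward_diff f L - forward_diff f 0 + 2) * (2 * (s / \<mu> + 1) + 3 / (2 * s))"
proof -
  let ?d = "forward_diff f" and ?cell = "\<lambda>m. {n \<in> {..<L}. \<lfloor>forward_diff f n\<rfloor> = m}"
  let ?B = "2 * (s / \<mu> + 1) + 3 / (2 * s)"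
  have "mono_on {..<L} (\<lambda>n. ?d n - \<mu> * real n)"
    by (rule monotone_on_subset[OF expanding]) auto
  then have cell: "norm (\<Sum>n\<in>?cell m. cis2pi (f n)) \<le> ?B" for m
    by (rule norm_sum_cis2pi_floor_eq_le[OF assms(1-3)])
  have "(\<Sum>n<L. cis2pi (f n)) = (\<Sum>m\<in>(\<lambda>n. \<lfloor>?d n\<rfloor>) ` {..L}. \<Sum>n\<in>?cell m. cis2pi (f n))"
    by (rule sum.group[symmetric]) auto
  also have "norm \<dots> \<le> real (card ((\<lambda>n. \<lfloor>?d n\<rfloor>) ` {..L})) * ?B"
    using cell by (intro sum_norm_bound)
  also have "\<dots> \<le> (?d L - ?d 0 + 2) * ?B"
    using assms(1,2) card_floor_image_le[OF mono_on_of_expanding[OF _ expanding]]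
    by (intro mult_right_mono) auto
  finally show ?thesis .
qed

lemma le_second_difference_bound:
  assumes "1 / 4 \<le> \<mu>" "1 \<le> h"
  shows "real L \<le> 10 * h * (real L * sqrt \<mu> + 1 / sqrt \<mu>)"
proof -
  have "1 / 2 \<le> sqrt \<mu>" using assms(1) by (intro real_le_rsqrt) (simp add: power2_eq_square)
  then have "1 * 1 \<le> (2 * h) * (2 * sqrt \<mu>)" using assms(2) by (intro mult_mono) auto
  also have "\<dots> \<le> 10 * h * sqrt \<mu>" using assms by simp
  finally have "real L * 1 \<le> real L * (10 * h * sqrt \<mu>)" by (intro mult_left_mono) auto
  also have "\<dots> = 10 * h * (real L * sqrt \<mu>)" by simp
  also have "\<dots> \<le> 10 * h * (real L * sqrt \<mu> + 1 / sqrt \<mu>)"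
    using assms by (intro mult_left_mono) auto
  finally show ?thesis by simp
qed

theorem second_difference_test:
  fixes f :: "nat \<Rightarrow> real"
  assumes "0 < \<mu>" "1 \<le> h"
    and range: "\<And>n. n < L \<Longrightarrow> forward_diff (forward_diff f) n \<in> {\<mu>..h * \<mu>}"
  shows "norm (\<Sum>n<L. cis2pi (f n)) \<le> 10 * h * (real L * sqrt \<mu> + 1 / sqrt \<mu>)"
proof (cases "1 / 4 \<le> \<mu>")
  case True
  then show ?thesis
    using norm_sum_cis_le[of "\<lambda>n. 2 * pi * f n" "{..<L}"] le_second_difference_bound[of \<mu> h L] assms(2)
    by simp
next
  case False
  define s where "s = sqrt \<mu>"
  have "sqrt \<mu> \<le> 1 / 2"
    using False \<open>0 < \<mu>\<close> by (intro real_le_lsqrt) (auto simp: power2_eq_square)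
  then have s: "0 < s" "s * s = \<mu>" "s \<le> 1 / 2"
    using \<open>0 < \<mu>\<close> by (auto simp: s_def)
  let ?d = "forward_diff f"
  have "?d L - ?d 0 = (\<Sum>n<L. forward_diff ?d n)"
    by (simp add: forward_diff_def[of ?d] sum_lessThan_telescope)
  also have "\<dots> \<le> real L * (h * \<mu>)"
    using sum_bounded_above[of "{..<L}" "forward_diff ?d" "h * \<mu>"] range by simp
  finally have increase: "?d L - ?d 0 + 2 \<le> real L * (h * \<mu>) + 2" by simp
  have "mono_on {..L} (\<lambda>n. ?d n - \<mu> * real n)"
    using range by (intro mono_on_atMost_SucI) (auto simp: forward_diff_def[of ?d] algebra_simps)
  then have "norm (\<Sum>n<L. cis2pi (f n)) \<le> (?d L - ?d 0 + 2) * (2 * (s / \<mu> + 1) + 3 / (2 * s))"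
    by (rule norm_sum_cis2pi_le_of_expanding[OF \<open>0 < \<mu>\<close> s(1,3)])
  also have "\<dots> \<le> (real L * (h * \<mu>) + 2) * (5 * (1 / s))"
  proof (intro mult_mono increase)
    have "2 * (s / \<mu> + 1) + 3 / (2 * s) = (7 / 2 + 2 * s) * (1 / s)"
      using s(1) by (simp add: field_simps flip: s(2))
    also have "\<dots> \<le> 5 * (1 / s)"
      using s by (intro mult_right_mono) auto
    finally show "2 * (s / \<mu> + 1) + 3 / (2 * s) \<le> 5 * (1 / s)" .
  qed (use s assms in auto)
  also have "\<dots> = 5 * h * (real L * s) + 10 * 1 * (1 / s)"
    using s(1) by (simp add: field_simps flip: s(2))
  also have "\<dots> \<le> 10 * h * (real L * s) + 10 * h * (1 / s)"
    using s \<open>1 \<le> h\<close> by (intro add_mono mult_right_mono) auto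
  finally show ?thesis by (simp add: s_def algebra_simps)
qed

section \<open>Van der Corput estimates by iterated differencing\<close>

definition autocorrelation :: "nat \<Rightarrow> (nat \<Rightarrow> complex) \<Rightarrow> nat \<Rightarrow> complex" where
  "autocorrelation L z t = (\<Sum>n<L - t. z (n + t) * cnj (z n))"

definition translate :: "nat \<Rightarrow> (nat \<Rightarrow> complex) \<Rightarrow> nat \<Rightarrow> nat \<Rightarrow> complex" where
  "translate L z r m = (if r \<le> m \<and> m < L + r then z (m - r) else 0)"

lemma sum_translate:
  assumes "r < q"
  shows "(\<Sum>m<L + q. translate L z r m) = (\<Sum>n<L. z n)"
proof -
  have "(\<Sum>m<L + q. translate L z r m) = (\<Sum>m\<in>{r..<L + r}. translate L z r m)"
    using assms by (intro sum.mono_neutral_right) (auto simp: translate_def)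
  also have "\<dots> = (\<Sum>n<L. z n)"
    by (rule sum.reindex_bij_witness[where i = "\<lambda>n. n + r" and j = "\<lambda>m. m - r"])
      (auto simp: translate_def)
  finally show ?thesis .
qed

lemma sum_translate_mult_cnj_translate:
  assumes "r \<le> s" "s < q"
  shows "(\<Sum>m<L + q. translate L z r m * cnj (translate L z s m)) = autocorrelation L z (s - r)"
proof -
  have "(\<Sum>m<L + q. translate L z r m * cnj (translate L z s m))
      = (\<Sum>m\<in>{s..<L + r}. translate L z r m * cnj (translate L z s m))"
    using assms by (intro sum.mono_neutral_right) (auto simp: translate_def)
  also have "\<dots> = (\<Sum>n<L - (s - r). z (n + (s - r)) * cnj (z n))"
    using assms
    by (intro sum.reindex_bij_witness[where i = "\<lambda>n. n + s" and j = "\<lambda>m. m - s"])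
      (auto simp: translate_def)
  finally show ?thesis by (simp add: autocorrelation_def)
qed

lemma norm_sum_translate_mult_cnj_translate:
  assumes "r < q" "s < q"
  shows "norm (\<Sum>m<L + q. translate L z r m * cnj (translate L z s m))
    = norm (autocorrelation L z (nat \<bar>int r - int s\<bar>))"
proof (cases "r \<le> s")
  case True
  then have "nat \<bar>int r - int s\<bar> = s - r" by simp
  then show ?thesis using True assms by (simp add: sum_translate_mult_cnj_translate)
next
  case False
  then have "nat \<bar>int r - int s\<bar> = r - s" by simp
  moreover have "(\<Sum>m<L + q. translate L z r m * cnj (translate L z s m))
      = cnj (\<Sum>m<L + q. translate L z s m * cnj (translate L z r m))"
    by (simp add: cnj_sum mult.commute)
  ultimately show ?thesis using False assms by (simp add: sum_translate_mult_cnj_translate)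
qed

lemma sum_norm_sum_squared_le:
  fixes a :: "'i \<Rightarrow> 'j \<Rightarrow> complex"
  shows "(\<Sum>m\<in>M. (norm (\<Sum>r\<in>R. a r m))\<^sup>2) \<le> (\<Sum>r\<in>R. \<Sum>s\<in>R. norm (\<Sum>m\<in>M. a r m * cnj (a s m)))"
proof -
  have "complex_of_real (\<Sum>m\<in>M. (norm (\<Sum>r\<in>R. a r m))\<^sup>2)
      = (\<Sum>m\<in>M. \<Sum>r\<in>R. \<Sum>s\<in>R. a r m * cnj (a s m))"
    by (simp add: complex_norm_square cnj_sum sum_product del: of_real_power)
  also have "\<dots> = (\<Sum>r\<in>R. \<Sum>m\<in>M. \<Sum>s\<in>R. a r m * cnj (a s m))"
    by (rule sum.swap)
  also have "\<dots> = (\<Sum>r\<in>R. \<Sum>s\<in>R. \<Sum>m\<in>M. a r m * cnj (a s m))"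
    by (intro sum.cong refl sum.swap)
  finally have "norm (complex_of_real (\<Sum>m\<in>M. (norm (\<Sum>r\<in>R. a r m))\<^sup>2))
      \<le> (\<Sum>r\<in>R. \<Sum>s\<in>R. norm (\<Sum>m\<in>M. a r m * cnj (a s m)))"
    by (simp only:) (intro sum_norm_le order_refl)
  then show ?thesis by (simp only: norm_of_real)
qed

lemma sum_abs_diff_le:
  fixes R :: "nat \<Rightarrow> real"
  assumes "r < q" and nonneg: "\<And>t. 0 \<le> R t"
  shows "(\<Sum>s<q. R (nat \<bar>int r - int s\<bar>)) \<le> R 0 + 2 * (\<Sum>t=1..<q. R t)"
proof -
  define g where "g s = R (nat \<bar>int r - int s\<bar>)" for s
  have "(\<Sum>s<q. g s) = (\<Sum>s<r. g s) + (\<Sum>s=r..<q. g s)"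
    using assms(1) by (simp add: lessThan_atLeast0 sum.atLeastLessThan_concat)
  also have "(\<Sum>s=r..<q. g s) = g r + (\<Sum>s=Suc r..<q. g s)"
    using assms(1) by (simp add: sum.atLeast_Suc_lessThan)
  also have "g r = R 0" by (simp add: g_def)
  also have "(\<Sum>s<r. g s) = (\<Sum>t=1..r. R t)"
    by (rule sum.reindex_bij_witness[where i = "\<lambda>t. r - t" and j = "\<lambda>s. r - s"])
      (auto simp: g_def nat_diff_distrib')
  also have "(\<Sum>s=Suc r..<q. g s) = (\<Sum>t=1..<q - r. R t)"
    by (rule sum.reindex_bij_witness[where i = "\<lambda>t. r + t" and j = "\<lambda>s. s - r"])
      (auto simp: g_def nat_diff_distrib')
  also have "(\<Sum>t=1..r. R t) + (R 0 + (\<Sum>t=1..<q - r. R t))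
      \<le> (\<Sum>t=1..<q. R t) + (R 0 + (\<Sum>t=1..<q. R t))"
    using nonneg assms(1) by (intro add_mono sum_mono2 order_refl) auto
  finally show ?thesis by (simp add: g_def)
qed

theorem van_der_corput_inequality:
  fixes z :: "nat \<Rightarrow> complex"
  shows "real q * (norm (\<Sum>n<L. z n))\<^sup>2 \<le> real (L + q) *
    (norm (autocorrelation L z 0) + 2 * (\<Sum>t=1..<q. norm (autocorrelation L z t)))"
proof (cases "q = 0")
  case False
  define C where "C = norm (autocorrelation L z 0) + 2 * (\<Sum>t=1..<q. norm (autocorrelation L z t))"
  define W where "W m = (\<Sum>r<q. translate L z r m)" for m
  have "(\<Sum>m<L + q. W m) = of_nat q * (\<Sum>n<L. z n)"
    unfolding W_def by (subst sum.swap) (simp add: sum_translate)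
  then have "(real q * norm (\<Sum>n<L. z n))\<^sup>2 = (norm (\<Sum>m<L + q. W m))\<^sup>2"
    by (simp add: norm_mult)
  also have "\<dots> \<le> (\<Sum>m<L + q. norm (W m))\<^sup>2"
    by (intro power_mono norm_sum) auto
  also have "\<dots> \<le> (\<Sum>m<L + q. (norm (W m))\<^sup>2) * real (L + q)"
    using sum_squared_le_sum_of_squares[of "\<lambda>m. norm (W m)" "{..<L + q}"] by simp
  also have "(\<Sum>m<L + q. (norm (W m))\<^sup>2) \<le> real q * C"
  proof -
    have "(\<Sum>m<L + q. (norm (W m))\<^sup>2)
        \<le> (\<Sum>r<q. \<Sum>s<q. norm (autocorrelation L z (nat \<bar>int r - int s\<bar>)))"
      unfolding W_def
      by (rule order_trans[OF sum_norm_sum_squared_le])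
        (simp add: norm_sum_translate_mult_cnj_translate)
    also have "\<dots> \<le> (\<Sum>r<q. C)"
      unfolding C_def by (intro sum_mono sum_abs_diff_le) auto
    finally show ?thesis by simp
  qed
  finally have "real q * (real q * (norm (\<Sum>n<L. z n))\<^sup>2) \<le> real q * (real (L + q) * C)"
    by (simp add: power_mult_distrib power2_eq_square mult_right_mono mult_ac)
  then show ?thesis using False by (simp add: C_def)
qed (simp add: sum_nonneg)

lemma funpow_forward_diff_shift_diff:
  "(forward_diff ^^ k) (\<lambda>n. f (n + t) - f n) n = (\<Sum>j<t. (forward_diff ^^ Suc k) f (n + j))"
proof -
  have "(forward_diff ^^ k) (\<lambda>n. f (n + t) - f n) n
      = (forward_diff ^^ k) f (n + t) - (forward_diff ^^ k) f n"
    by (induction k arbitrary: n) (simp_all add: forward_diff_def)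
  also have "\<dots> = (\<Sum>j<t. (forward_diff ^^ Suc k) f (n + j))"
    using sum_lessThan_telescope[of "\<lambda>j. (forward_diff ^^ k) f (n + j)" t]
    by (simp add: forward_diff_def)
  finally show ?thesis .
qed

definition vdc_bound :: "real \<Rightarrow> real \<Rightarrow> real \<Rightarrow> real \<Rightarrow> real" where
  "vdc_bound E \<delta> M \<mu> = M * \<mu> powr E + M powr (1 - \<delta>) * \<mu> powr (- E)"

lemma vdc_bound_nonneg: "0 \<le> M \<Longrightarrow> 0 \<le> vdc_bound E \<delta> M \<mu>"
  by (simp add: vdc_bound_def)

lemma vdc_bound_mono:
  assumes "0 \<le> M" "M \<le> M'" "\<delta> \<le> 1"
  shows "vdc_bound E \<delta> M \<mu> \<le> vdc_bound E \<delta> M' \<mu>"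
  unfolding vdc_bound_def using assms by (intro add_mono mult_right_mono powr_mono2) auto

lemma vdc_bound_scale_le:
  assumes "0 < c" "c \<le> 1" "0 \<le> E" "0 \<le> M" "0 \<le> \<mu>"
  shows "vdc_bound E \<delta> M (c * \<mu>) \<le> c powr (- E) * vdc_bound E \<delta> M \<mu>"
proof -
  have "c powr E \<le> c powr (- E)" using assms by (intro powr_mono') auto
  then have "c powr E * (M * \<mu> powr E) \<le> c powr (- E) * (M * \<mu> powr E)"
    using assms by (intro mult_right_mono) auto
  then show ?thesis
    using assms by (simp add: vdc_bound_def powr_mult algebra_simps)
qed

lemma sum_vdc_bound_le:
  assumes "0 \<le> E" "E \<le> 1 / 2" "0 \<le> M" "0 < \<mu>"
  shows "(\<Sum>t=1..<q. vdc_bound E \<delta> M (real t * \<mu>)) \<le> 2 * real q * vdc_bound E \<delta> M (real q * \<mu>)"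
proof (cases "q = 0")
  case False
  define m where "m = M powr (1 - \<delta>)"
  have "(\<Sum>t=1..<q. vdc_bound E \<delta> M (real t * \<mu>))
      \<le> (\<Sum>t=1..<q. M * (real q * \<mu>) powr E + m * \<mu> powr (- E) * real t powr (- E))"
    using assms unfolding vdc_bound_def m_def
    by (intro sum_mono add_mono mult_left_mono powr_mono2) (auto simp: powr_mult)
  also have "\<dots> = real (q - 1) * (M * (real q * \<mu>) powr E)
      + m * \<mu> powr (- E) * (\<Sum>t=1..<q. real t powr (- E))"
    by (simp add: sum.distrib sum_distrib_left)
  also have "\<dots> \<le> 2 * real q * (M * (real q * \<mu>) powr E)
      + m * \<mu> powr (- E) * (2 * real q powr (1 - E))"
  proof (intro add_mono mult_right_mono mult_left_mono)
    have "(\<Sum>t=1..<q. real t powr (- E)) \<le> (\<Sum>t=1..q. real t powr (- E))"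
      by (intro sum_mono2) auto
    also have "\<dots> \<le> real q powr (1 - E) / (1 - E)"
      using assms by (intro sum_powr_minus_le) auto
    also have "\<dots> \<le> real q powr (1 - E) / (1 / 2)"
      using assms by (intro divide_left_mono) auto
    finally show "(\<Sum>t=1..<q. real t powr (- E)) \<le> 2 * real q powr (1 - E)" by simp
  qed (use assms in \<open>auto simp: m_def\<close>)
  also have "real q powr (1 - E) = real q * real q powr (- E)"
    using False by (simp add: powr_diff powr_minus_divide)
  also have "2 * real q * (M * (real q * \<mu>) powr E)
      + m * \<mu> powr (- E) * (2 * (real q * real q powr (- E)))
      = 2 * real q * vdc_bound E \<delta> M (real q * \<mu>)"
    using assms by (simp add: vdc_bound_def m_def powr_mult algebra_simps)
  finally show ?thesis .
qed simp

lemma le_vdc_bound: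
  assumes "0 \<le> F" "0 \<le> \<delta>" "\<delta> \<le> 1 / 2" "0 < \<mu>" and "1 \<le> \<mu> \<or> real L \<le> \<mu> powr (- 2 * F)"
  shows "real L \<le> vdc_bound F \<delta> (real L) \<mu>"
  using assms(5)
proof
  assume "1 \<le> \<mu>"
  then have "real L * 1 \<le> real L * \<mu> powr F"
    using assms by (intro mult_left_mono) (auto simp: ge_one_powr_ge_zero)
  then show ?thesis unfolding vdc_bound_def by (simp add: add_increasing2)
next
  assume short: "real L \<le> \<mu> powr (- 2 * F)"
  show ?thesis
  proof (cases "L = 0")
    case False
    then have "real L = real L powr (1 / 2) * real L powr (1 / 2)"
      by (simp flip: powr_add)
    also have "\<dots> \<le> real L powr (1 - \<delta>) * (\<mu> powr (- 2 * F)) powr (1 / 2)"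
      using False short assms by (intro mult_mono powr_mono powr_mono2) auto
    also have "\<dots> = real L powr (1 - \<delta>) * \<mu> powr (- F)" by (simp add: powr_powr)
    finally show ?thesis unfolding vdc_bound_def by (simp add: add_increasing)
  qed (simp add: vdc_bound_nonneg)
qed

lemma norm_sum_cis2pi_squared_le:
  assumes "1 \<le> q" "q \<le> L" "0 \<le> E" "E \<le> 1 / 2" "0 \<le> \<delta>" "\<delta> \<le> 1" "0 \<le> A" "0 < \<mu>"
    and diff: "\<And>t. 1 \<le> t \<Longrightarrow> t < L \<Longrightarrow>
      norm (\<Sum>n<L - t. cis2pi (f (n + t) - f n)) \<le> A * vdc_bound E \<delta> (real (L - t)) (real t * \<mu>)"
  shows "(norm (\<Sum>n<L. cis2pi (f n)))\<^sup>2
    \<le> 2 * real L * (real L / real q + 4 * A * vdc_bound E \<delta> (real L) (real q * \<mu>))"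
proof -
  let ?z = "\<lambda>n. cis2pi (f n)" and ?V = "vdc_bound E \<delta> (real L) (real q * \<mu>)"
  have autocorrelation: "autocorrelation L ?z t = (\<Sum>n<L - t. cis2pi (f (n + t) - f n))" for t
    by (simp add: autocorrelation_def cis_cnj cis_mult right_diff_distrib)
  have "(\<Sum>t=1..<q. norm (autocorrelation L ?z t))
      \<le> (\<Sum>t=1..<q. A * vdc_bound E \<delta> (real L) (real t * \<mu>))"
  proof (intro sum_mono)
    fix t assume t: "t \<in> {1..<q}"
    then have "norm (autocorrelation L ?z t) \<le> A * vdc_bound E \<delta> (real (L - t)) (real t * \<mu>)"
      unfolding autocorrelation using assms(2) by (intro diff) auto
    also have "\<dots> \<le> A * vdc_bound E \<delta> (real L) (real t * \<mu>)"
      using assms(6,7) by (intro mult_left_mono vdc_bound_mono) auto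
    finally show "norm (autocorrelation L ?z t) \<le> A * vdc_bound E \<delta> (real L) (real t * \<mu>)" .
  qed
  also have "\<dots> \<le> A * (2 * real q * ?V)"
    unfolding sum_distrib_left[symmetric] using assms by (intro mult_left_mono sum_vdc_bound_le) auto
  finally have correlations: "(\<Sum>t=1..<q. norm (autocorrelation L ?z t)) \<le> A * (2 * real q * ?V)" .
  have "real q * (norm (\<Sum>n<L. ?z n))\<^sup>2
      \<le> real (L + q) *
        (norm (autocorrelation L ?z 0) + 2 * (\<Sum>t=1..<q. norm (autocorrelation L ?z t)))"
    by (rule van_der_corput_inequality)
  also have "\<dots> \<le> (2 * real L) * (real L + 2 * (A * (2 * real q * ?V)))"
    using correlations assms(2)
    by (intro mult_mono add_mono mult_left_mono) (auto simp: autocorrelation sum_nonneg)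
  also have "\<dots> = real q * (2 * real L * (real L / real q + 4 * A * ?V))"
    using assms(1) by (simp add: field_simps)
  finally show ?thesis using assms(1) by simp
qed

text \<open>The shift length \<open>\<rho> = \<mu>\<^bsup>-2F\<^esup>\<close> is the one with \<open>(\<rho> \<mu>)\<^bsup>E\<^esup> = 1 / \<rho>\<close>.\<close>

lemma vdc_bound_balanced:
  fixes E \<mu> M :: real
  defines "F \<equiv> E / (2 * (1 + E))"
  assumes "0 < E" "0 \<le> M" "0 < \<mu>"
  shows "M * vdc_bound E \<delta> M (\<mu> powr (- 2 * F) * \<mu>)
    = (M * \<mu> powr F)\<^sup>2 + (M powr (1 - \<delta> / 2) * \<mu> powr (- F))\<^sup>2"
proof -
  have "(1 - 2 * F) * E = 2 * F" using assms(2) by (simp add: F_def field_simps)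
  then have powr_E: "(\<mu> powr (- 2 * F) * \<mu>) powr E = \<mu> powr (2 * F)"
    using \<open>0 < \<mu>\<close> by (simp add: powr_mult_base powr_powr mult.commute)
  then have powr_minus_E: "(\<mu> powr (- 2 * F) * \<mu>) powr (- E) = \<mu> powr (- 2 * F)"
    by (simp add: powr_minus)
  have "M * M powr (1 - \<delta>) = (M powr (1 - \<delta> / 2))\<^sup>2"
    using \<open>0 \<le> M\<close> by (cases "M = 0") (simp_all add: powr_mult_base power2_eq_square flip: powr_add)
  moreover have "\<mu> powr (2 * F) = (\<mu> powr F)\<^sup>2" "\<mu> powr (- 2 * F) = (\<mu> powr (- F))\<^sup>2"
    by (simp_all add: power2_eq_square flip: powr_add)
  ultimately show ?thesis
    unfolding vdc_bound_def powr_E powr_minus_E by (simp add: power2_eq_square algebra_simps)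
qed

lemma vdc_bound_floor_le:
  assumes "1 \<le> \<rho>" "0 \<le> E" "E \<le> 1" "0 \<le> M" "0 \<le> \<mu>"
  shows "vdc_bound E \<delta> M (of_int \<lfloor>\<rho>\<rfloor> * \<mu>) \<le> 2 * vdc_bound E \<delta> M (\<rho> * \<mu>)"
proof -
  define c where "c = of_int \<lfloor>\<rho>\<rfloor> / \<rho>"
  have c: "1 / 2 \<le> c" "c \<le> 1" and floor: "of_int \<lfloor>\<rho>\<rfloor> = c * \<rho>"
  proof -
    have "1 \<le> \<lfloor>\<rho>\<rfloor>" using assms(1) by simp
    then have "\<rho> \<le> 2 * of_int \<lfloor>\<rho>\<rfloor>" by linarith
    then show "1 / 2 \<le> c" using assms(1) by (simp add: c_def field_simps)
  qed (use assms(1) in \<open>simp_all add: c_def\<close>)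
  have "vdc_bound E \<delta> M (c * (\<rho> * \<mu>)) \<le> c powr (- E) * vdc_bound E \<delta> M (\<rho> * \<mu>)"
    using assms c by (intro vdc_bound_scale_le) auto
  also have "c powr (- E) \<le> (1 / 2) powr (- E)"
    using c assms by (intro powr_mono2') auto
  also have "\<dots> = 2 powr E" by (simp add: powr_divide powr_minus_divide)
  also have "\<dots> \<le> 2 powr 1" using assms by (intro powr_mono) auto
  finally show ?thesis
    using assms(4) by (simp add: floor mult.assoc mult_right_mono vdc_bound_nonneg)
qed

lemma four_square_add_le_square_sum:
  fixes a b A :: real
  assumes "0 \<le> a" "0 \<le> b" "1 \<le> A"
  shows "4 * a\<^sup>2 + 16 * A * (a\<^sup>2 + b\<^sup>2) \<le> (5 * A * (a + b))\<^sup>2"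
proof -
  have "4 * a\<^sup>2 + 16 * A * (a\<^sup>2 + b\<^sup>2) \<le> (9 * A) * (a\<^sup>2 + b\<^sup>2) + 16 * A * (a\<^sup>2 + b\<^sup>2)"
    using assms by (intro add_right_mono mult_mono) auto
  also have "\<dots> = 25 * A * (a\<^sup>2 + b\<^sup>2)" by (simp add: algebra_simps)
  also have "\<dots> \<le> (5 * A)\<^sup>2 * (a + b)\<^sup>2"
  proof (intro mult_mono)
    have "A * 1 \<le> A * A" using assms by (intro mult_left_mono) auto
    then show "25 * A \<le> (5 * A)\<^sup>2" by (simp add: power2_eq_square)
  qed (use assms in \<open>auto simp: power2_sum\<close>)
  finally show ?thesis by (simp add: power_mult_distrib)
qed

lemma norm_sum_cis2pi_le_balanced:
  fixes f :: "nat \<Rightarrow> real" and E \<delta> A \<mu> :: real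
  defines "F \<equiv> E / (2 * (1 + E))"
  defines "\<rho> \<equiv> \<mu> powr (- 2 * F)"
  assumes "0 < E" "E \<le> 1 / 2" "0 \<le> \<delta>" "\<delta> \<le> 1" "1 \<le> A" "0 < \<mu>" "1 \<le> \<rho>" "\<rho> \<le> real L"
    and diff: "\<And>t. 1 \<le> t \<Longrightarrow> t < L \<Longrightarrow>
      norm (\<Sum>n<L - t. cis2pi (f (n + t) - f n)) \<le> A * vdc_bound E \<delta> (real (L - t)) (real t * \<mu>)"
  shows "norm (\<Sum>n<L. cis2pi (f n)) \<le> 5 * A * vdc_bound F (\<delta> / 2) (real L) \<mu>"
proof -
  define q where "q = nat \<lfloor>\<rho>\<rfloor>"
  have floor: "real q = of_int \<lfloor>\<rho>\<rfloor>" "1 \<le> \<lfloor>\<rho>\<rfloor>" using \<open>1 \<le> \<rho>\<close> by (simp_all add: q_def)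
  then have q: "1 \<le> q" "q \<le> L" "\<rho> \<le> 2 * real q"
    using \<open>\<rho> \<le> real L\<close> by linarith+
  let ?V = "vdc_bound E \<delta> (real L) (\<rho> * \<mu>)"
  let ?a = "real L * \<mu> powr F" and ?b = "real L powr (1 - \<delta> / 2) * \<mu> powr (- F)"
  have balanced: "real L * ?V = ?a\<^sup>2 + ?b\<^sup>2"
    unfolding \<rho>_def F_def using assms by (intro vdc_bound_balanced) auto
  have "(norm (\<Sum>n<L. cis2pi (f n)))\<^sup>2
      \<le> 2 * real L * (real L / real q + 4 * A * vdc_bound E \<delta> (real L) (real q * \<mu>))"
    using assms q by (intro norm_sum_cis2pi_squared_le) auto
  also have "\<dots> \<le> 2 * real L * (2 * (real L / \<rho>) + 4 * A * (2 * ?V))"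
  proof (intro mult_left_mono add_mono)
    show "real L / real q \<le> 2 * (real L / \<rho>)"
      using q \<open>1 \<le> \<rho>\<close> by (simp add: field_simps mult_left_mono)
    show "vdc_bound E \<delta> (real L) (real q * \<mu>) \<le> 2 * ?V"
      unfolding floor(1) using assms by (intro vdc_bound_floor_le) auto
  qed (use assms in auto)
  also have "\<dots> = 4 * (real L * (real L / \<rho>)) + 16 * A * (real L * ?V)"
    by (simp add: algebra_simps)
  also have "real L * (real L / \<rho>) = ?a\<^sup>2"
    using \<open>0 < \<mu>\<close> by (simp add: \<rho>_def power2_eq_square powr_minus_divide flip: powr_add)
  also have "4 * ?a\<^sup>2 + 16 * A * (real L * ?V) \<le> (5 * A * (?a + ?b))\<^sup>2"
    unfolding balanced using \<open>1 \<le> A\<close> by (intro four_square_add_le_square_sum) auto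
  finally have "norm (\<Sum>n<L. cis2pi (f n)) \<le> 5 * A * (?a + ?b)"
    by (rule power2_le_imp_le) (use \<open>1 \<le> A\<close> in auto)
  then show ?thesis by (simp add: vdc_bound_def)
qed

lemma van_der_corput_step:
  fixes f :: "nat \<Rightarrow> real" and E \<delta> A \<mu> :: real
  defines "F \<equiv> E / (2 * (1 + E))"
  assumes "0 < E" "E \<le> 1 / 2" "0 \<le> \<delta>" "\<delta> \<le> 1" "1 \<le> A" "0 < \<mu>"
    and diff: "\<And>t. 1 \<le> t \<Longrightarrow> t < L \<Longrightarrow>
      norm (\<Sum>n<L - t. cis2pi (f (n + t) - f n)) \<le> A * vdc_bound E \<delta> (real (L - t)) (real t * \<mu>)"
  shows "norm (\<Sum>n<L. cis2pi (f n)) \<le> 5 * A * vdc_bound F (\<delta> / 2) (real L) \<mu>"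
proof -
  define \<rho> where "\<rho> = \<mu> powr (- 2 * F)"
  have "0 < F" using assms(2) by (simp add: F_def)
  consider (trivial) "1 \<le> \<mu> \<or> real L \<le> \<rho>" | (differencing) "\<mu> < 1" "\<rho> \<le> real L" by linarith
  then show ?thesis
  proof cases
    case trivial
    have "norm (\<Sum>n<L. cis2pi (f n)) \<le> real L"
      using norm_sum_cis_le[of "\<lambda>n. 2 * pi * f n" "{..<L}"] by simp
    also have "\<dots> \<le> 1 * vdc_bound F (\<delta> / 2) (real L) \<mu>"
      using le_vdc_bound[of F "\<delta> / 2" \<mu> L] trivial \<open>0 < F\<close> assms by (simp add: \<rho>_def)
    also have "\<dots> \<le> 5 * A * vdc_bound F (\<delta> / 2) (real L) \<mu>"
      using assms by (intro mult_right_mono vdc_bound_nonneg) auto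
    finally show ?thesis .
  next
    case differencing
    then have "1 \<le> \<rho>"
      unfolding \<rho>_def using \<open>0 < F\<close> \<open>0 < \<mu>\<close> by (simp add: powr_minus_divide powr_le1)
    then show ?thesis
      using assms differencing unfolding \<rho>_def F_def by (intro norm_sum_cis2pi_le_balanced)
  qed
qed

definition vdc_exp :: "nat \<Rightarrow> real" where
  "vdc_exp k = 1 / (2 ^ k - 2)"

text \<open>The loss exponent is 1 for order 2 and is halved by every differencing step.\<close>

abbreviation vdc_order_bound :: "nat \<Rightarrow> real \<Rightarrow> real \<Rightarrow> real" where
  "vdc_order_bound k \<equiv> vdc_bound (vdc_exp k) (4 / 2 ^ k)"

lemma vdc_exp_Suc:
  assumes "2 \<le> k"
  shows "vdc_exp (Suc k) = vdc_exp k / (2 * (1 + vdc_exp k))"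
  using four_le_two_power[OF assms] by (simp add: vdc_exp_def field_simps)

lemma vdc_exp_bounds:
  assumes "2 \<le> k"
  shows "0 < vdc_exp k" "vdc_exp k \<le> 1 / 2"
  using four_le_two_power[OF assms] by (simp_all add: vdc_exp_def field_simps)

theorem van_der_corput:
  assumes "2 \<le> k" "1 \<le> h" "0 < \<mu>"
    and "\<And>n. n < L \<Longrightarrow> (forward_diff ^^ k) f n \<in> {\<mu>..h * \<mu>}"
  shows "norm (\<Sum>n<L. cis2pi (f n)) \<le> 5 ^ k * h * vdc_order_bound k (real L) \<mu>"
  using assms(1,3,4)
proof (induction k arbitrary: f L \<mu> rule: dec_induct)
  case base
  show ?case
  proof (cases "L = 0")
    case False
    have "norm (\<Sum>n<L. cis2pi (f n)) \<le> 10 * h * (real L * sqrt \<mu> + 1 / sqrt \<mu>)"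
      using base \<open>1 \<le> h\<close> by (intro second_difference_test) (auto simp: numeral_2_eq_2)
    also have "\<dots> = 10 * h * vdc_order_bound 2 (real L) \<mu>"
      using False base(1)
      by (simp add: vdc_bound_def vdc_exp_def powr_minus_divide less_imp_le flip: powr_half_sqrt)
    also have "\<dots> \<le> 5 ^ 2 * h * vdc_order_bound 2 (real L) \<mu>"
      using \<open>1 \<le> h\<close> by (intro mult_right_mono vdc_bound_nonneg) auto
    finally show ?thesis .
  qed (simp add: vdc_bound_def)
next
  case (step k)
  have "norm (\<Sum>n<L. cis2pi (f n)) \<le> 5 * (5 ^ k * h) *
      vdc_bound (vdc_exp k / (2 * (1 + vdc_exp k))) (4 / 2 ^ k / 2) (real L) \<mu>"
  proof (rule van_der_corput_step)
    fix t assume t: "1 \<le> t" "t < L"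
    show "norm (\<Sum>n<L - t. cis2pi (f (n + t) - f n))
        \<le> 5 ^ k * h * vdc_order_bound k (real (L - t)) (real t * \<mu>)"
    proof (rule step.IH)
      fix n assume n: "n < L - t"
      have "(\<Sum>j<t. (forward_diff ^^ Suc k) f (n + j)) \<in> {(\<Sum>j<t. \<mu>)..(\<Sum>j<t. h * \<mu>)}"
        unfolding atLeastAtMost_iff using step.prems(2) n by (intro conjI sum_mono) auto
      then show "(forward_diff ^^ k) (\<lambda>n. f (n + t) - f n) n \<in> {real t * \<mu>..h * (real t * \<mu>)}"
        unfolding funpow_forward_diff_shift_diff by (simp add: mult_ac)
    qed (use t step.prems in simp)
  next
    have "(1::real) \<le> 5 ^ k" by simp
    then show "1 \<le> 5 ^ k * h" using \<open>1 \<le> h\<close> mult_mono[of 1 "5 ^ k" 1 h] by simp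
    show "4 / 2 ^ k \<le> (1::real)"
      using four_le_two_power[OF \<open>2 \<le> k\<close>] by simp
  qed (use vdc_exp_bounds[OF \<open>2 \<le> k\<close>] step.prems(1) in auto)
  then show ?case using vdc_exp_Suc[OF \<open>2 \<le> k\<close>] by (simp add: mult.assoc mult.commute[of 2])
qed

section \<open>The phase \<open>x / n\<close>\<close>

lemma funpow_forward_diff_reciprocal:
  fixes a c :: real
  assumes "0 < a"
  shows "(forward_diff ^^ k) (\<lambda>n. c / (a + real n)) n
    = (- 1) ^ k * c * fact k / pochhammer (a + real n) (Suc k)"
proof (induction k arbitrary: n)
  case (Suc k)
  define m where "m = a + real n"
  define C where "C = (- 1) ^ k * c * fact k"
  define P where "P = pochhammer m (Suc (Suc k))"
  have "0 < m" using assms by (simp add: m_def)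
  have "P = m * pochhammer (m + 1) (Suc k)"
    unfolding P_def by (rule pochhammer_rec)
  then have shifted: "C / pochhammer (m + 1) (Suc k) = C * m / P"
    using \<open>0 < m\<close> by (simp del: pochhammer_Suc)
  have "P = (m + real (Suc k)) * pochhammer m (Suc k)"
    unfolding P_def by (rule pochhammer_rec')
  then have unshifted: "C / pochhammer m (Suc k) = C * (m + real (Suc k)) / P"
    using \<open>0 < m\<close> by (simp del: pochhammer_Suc of_nat_Suc)
  have "(forward_diff ^^ Suc k) (\<lambda>n. c / (a + real n)) n
      = C / pochhammer (m + 1) (Suc k) - C / pochhammer m (Suc k)"
    by (simp add: forward_diff_def Suc C_def m_def add_ac del: pochhammer_Suc)
  also have "\<dots> = (C * m - C * (m + real (Suc k))) / P"
    unfolding shifted unshifted by (rule diff_divide_distrib[symmetric])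
  also have "C * m - C * (m + real (Suc k)) = (- 1) ^ Suc k * c * fact (Suc k)"
    by (simp add: C_def algebra_simps)
  finally show ?case by (simp only: P_def m_def)
qed simp

lemma funpow_forward_diff_reciprocal_bounds:
  fixes c :: real and k N n :: nat
  defines "\<mu> \<equiv> c / ((real k + 2) * real N) ^ Suc k"
  assumes "0 \<le> c" "n < N"
  shows "(forward_diff ^^ k) (\<lambda>n. (- 1) ^ k * c / (real N + real n)) n
    \<in> {\<mu>..fact k * (real k + 2) ^ Suc k * \<mu>}"
proof -
  define P where "P = pochhammer (real N + real n) (Suc k)"
  have "real N ^ Suc k \<le> (real N + real n) ^ Suc k" by (intro power_mono) auto
  also have "\<dots> \<le> P" unfolding P_def by (rule power_le_pochhammer) simp
  finally have lower: "real N ^ Suc k \<le> P" .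
  have "P \<le> (real N + real n + real (Suc k)) ^ Suc k"
    unfolding P_def by (rule pochhammer_le_power) simp
  also have "\<dots> \<le> ((real k + 2) * real N) ^ Suc k"
  proof (intro power_mono)
    have "real k * 1 \<le> real k * real N" using assms(3) by (intro mult_left_mono) auto
    moreover have "real (Suc n) \<le> real N" using assms(3) by simp
    ultimately show "real N + real n + real (Suc k) \<le> (real k + 2) * real N"
      by (simp add: algebra_simps)
  qed simp
  finally have upper: "P \<le> ((real k + 2) * real N) ^ Suc k" .
  have pos: "0 < real N ^ Suc k" using assms(3) by simp
  with lower have "0 < P" by linarith
  have "(- 1) ^ k * (- 1) ^ k = (1 :: real)" by (simp flip: power_mult_distrib)
  then have "(forward_diff ^^ k) (\<lambda>n. (- 1) ^ k * c / (real N + real n)) n = c * fact k / P"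
    using funpow_forward_diff_reciprocal[of "real N" k "(- 1) ^ k * c" n] assms(3)
    by (simp add: P_def mult.assoc[symmetric] del: pochhammer_Suc)
  moreover have "\<mu> \<le> c * fact k / P"
    unfolding \<mu>_def using assms(2) upper \<open>0 < P\<close> by (intro frac_le) (auto simp: mult_le_cancel_left1)
  moreover have "c * fact k / P \<le> c * fact k / real N ^ Suc k"
    using assms(2) lower pos by (intro divide_left_mono) auto
  moreover have "c * fact k / real N ^ Suc k = fact k * (real k + 2) ^ Suc k * \<mu>"
    unfolding \<mu>_def power_mult_distrib by simp
  ultimately show ?thesis by simp
qed

lemma norm_sum_cis2pi_sign:
  "norm (\<Sum>n\<in>X. cis2pi ((- 1) ^ k * f n)) = norm (\<Sum>n\<in>X. cis2pi (f n))"
proof (cases "even k")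
  case False
  then have "(\<Sum>n\<in>X. cis2pi ((- 1) ^ k * f n)) = cnj (\<Sum>n\<in>X. cis2pi (f n))"
    by (simp add: cis_cnj)
  then show ?thesis by (simp only: complex_mod_cnj)
qed simp

definition reciprocal_vdc_const :: "nat \<Rightarrow> real" where
  "reciprocal_vdc_const k
    = 5 ^ k * (fact k * (real k + 2) ^ Suc k) * (2 * pi * (real k + 2) ^ Suc k) powr vdc_exp k"

lemma reciprocal_vdc_const_nonneg: "0 \<le> reciprocal_vdc_const k"
  by (simp add: reciprocal_vdc_const_def)

theorem norm_sum_cis_reciprocal_le:
  assumes "2 \<le> k" "0 < x" "1 \<le> N" "N' \<le> 2 * N"
  shows "norm (\<Sum>n=N..<N'. cis (x / real n))
    \<le> reciprocal_vdc_const k * vdc_order_bound k (real N) (x / real N ^ Suc k)"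
proof -
  define H :: real where "H = (real k + 2) ^ Suc k"
  define f where "f n = x / (2 * pi) / (real N + real n)" for n
  let ?\<mu> = "x / (2 * pi) / ((real k + 2) * real N) ^ Suc k"
  have H_ge_1: "1 \<le> H" unfolding H_def by (rule one_le_power) simp
  then have ratio: "1 \<le> fact k * H" using mult_mono[of 1 "fact k" 1 H] by simp
  have loss_le_1: "4 / 2 ^ k \<le> (1::real)" using four_le_two_power[OF assms(1)] by simp
  have \<mu>_eq: "?\<mu> = 1 / (2 * pi * H) * (x / real N ^ Suc k)"
    by (simp add: H_def power_mult_distrib mult_ac)
  have "(\<Sum>n=N..<N'. cis (x / real n)) = (\<Sum>n<N' - N. cis2pi (f n))"
    by (simp add: f_def sum.atLeastLessThan_shift_0[of _ N] lessThan_atLeast0)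
  then have "norm (\<Sum>n=N..<N'. cis (x / real n)) = norm (\<Sum>n<N' - N. cis2pi ((- 1) ^ k * f n))"
    by (simp only: norm_sum_cis2pi_sign)
  also have "\<dots> \<le> 5 ^ k * (fact k * H) * vdc_order_bound k (real (N' - N)) ?\<mu>"
  proof (rule van_der_corput[OF assms(1) ratio])
    show "0 < ?\<mu>" using assms by simp
    show "(forward_diff ^^ k) (\<lambda>n. (- 1) ^ k * f n) n \<in> {?\<mu>..fact k * H * ?\<mu>}" if "n < N' - N" for n
      using funpow_forward_diff_reciprocal_bounds[of "x / (2 * pi)" n N k] that assms
      by (simp add: f_def H_def)
  qed
  also have "\<dots> \<le> 5 ^ k * (fact k * H) * vdc_order_bound k (real N) ?\<mu>"
    using assms loss_le_1 H_ge_1 by (intro mult_left_mono vdc_bound_mono) auto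
  also have "\<dots> \<le> 5 ^ k * (fact k * H) *
      ((1 / (2 * pi * H)) powr (- vdc_exp k) * vdc_order_bound k (real N) (x / real N ^ Suc k))"
  proof (intro mult_left_mono)
    have "1 * 1 \<le> 2 * pi * H" using H_ge_1 pi_ge_two by (intro mult_mono) auto
    then show "vdc_order_bound k (real N) ?\<mu>
        \<le> (1 / (2 * pi * H)) powr (- vdc_exp k) * vdc_order_bound k (real N) (x / real N ^ Suc k)"
      unfolding \<mu>_eq using vdc_exp_bounds[OF assms(1)] assms H_ge_1 by (intro vdc_bound_scale_le) auto
  qed (use H_ge_1 in simp)
  also have "(1 / (2 * pi * H)) powr (- vdc_exp k) = (2 * pi * H) powr vdc_exp k"
    using H_ge_1 by (simp add: powr_divide powr_minus_divide)
  finally show ?thesis by (simp add: reciprocal_vdc_const_def H_def mult.assoc)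
qed

section \<open>Choice of the order\<close>

definition hl_saving :: "nat \<Rightarrow> real \<Rightarrow> real" where
  "hl_saving k \<theta> = min ((real (Suc k) * \<theta> - 1) * vdc_exp k)
    (\<theta> * (4 / 2 ^ k) - (real (Suc k) * \<theta> - 1) * vdc_exp k)"

lemma vdc_bound_powr_le:
  assumes "1 \<le> x"
  shows "vdc_order_bound k (x powr \<theta>) (x / (x powr \<theta>) ^ Suc k) / x powr \<theta>
    \<le> 2 * x powr (- hl_saving k \<theta>)"
proof -
  define s where "s = (real (Suc k) * \<theta> - 1) * vdc_exp k"
  have "(x powr \<theta>) ^ Suc k = x powr (real (Suc k) * \<theta>)"
    using assms by (simp add: powr_powr mult.commute flip: powr_realpow del: power_Suc of_nat_Suc)
  then have ratio_eq: "x / (x powr \<theta>) ^ Suc k = x powr (1 - real (Suc k) * \<theta>)"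
    using assms by (simp add: powr_diff)
  have ratio_powr: "(x / (x powr \<theta>) ^ Suc k) powr vdc_exp k = x powr (- s)"
      "(x / (x powr \<theta>) ^ Suc k) powr (- vdc_exp k) = x powr s"
    unfolding ratio_eq powr_powr s_def by (simp_all add: algebra_simps)
  have "vdc_order_bound k (x powr \<theta>) (x / (x powr \<theta>) ^ Suc k) / x powr \<theta>
      = x powr (- s) + x powr (- (\<theta> * (4 / 2 ^ k) - s))"
  proof -
    have "(x powr \<theta>) powr (1 - 4 / 2 ^ k) * x powr s / x powr \<theta>
        = x powr (\<theta> * (1 - 4 / 2 ^ k) + s - \<theta>)"
      by (simp only: powr_powr powr_add[symmetric] powr_diff[symmetric])
    also have "\<theta> * (1 - 4 / 2 ^ k) + s - \<theta> = - (\<theta> * (4 / 2 ^ k) - s)"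
      by (simp add: algebra_simps)
    finally show ?thesis
      using assms unfolding vdc_bound_def ratio_powr by (simp add: add_divide_distrib)
  qed
  also have "\<dots> \<le> x powr (- hl_saving k \<theta>) + x powr (- hl_saving k \<theta>)"
    using assms by (intro add_mono powr_mono) (auto simp: hl_saving_def s_def)
  finally show ?thesis by simp
qed

lemma hl_delta_mono:
  assumes "0 < e" "e \<le> t"
  shows "hl_delta e \<le> hl_delta t"
  unfolding hl_delta_def using assms
  by (intro mult_mono powr_mono) (auto simp: field_simps)

lemma hl_delta_le:
  assumes "0 < e" "e \<le> 1 / 2"
  shows "hl_delta e \<le> 1 / 8"
proof -
  have "hl_delta e \<le> hl_delta (1 / 2)" using assms by (intro hl_delta_mono) auto
  then show ?thesis by (simp add: hl_delta_def powr_minus_divide)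
qed

text \<open>The endpoints are the values of \<open>1/\<theta>\<close> where estimates of consecutive orders are equally strong.\<close>

lemma ex_vdc_order:
  fixes \<alpha> :: real
  assumes "2 < \<alpha>"
  shows "\<exists>k\<ge>2. real k - 1 + 4 / 2 ^ k \<le> \<alpha> \<and> \<alpha> \<le> real k + 2 / 2 ^ k"
proof -
  define k where "k = (LEAST k. \<alpha> \<le> real k + 2 / 2 ^ k)"
  have "\<alpha> \<le> real (nat \<lceil>\<alpha>\<rceil>)" by linarith
  also have "\<dots> \<le> real (nat \<lceil>\<alpha>\<rceil>) + 2 / 2 ^ nat \<lceil>\<alpha>\<rceil>" by simp
  finally have upper: "\<alpha> \<le> real k + 2 / 2 ^ k" unfolding k_def by (rule LeastI)
  have "k \<noteq> 0" using upper assms by (intro notI) simp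
  moreover have "k \<noteq> 1" using upper assms by (intro notI) simp
  ultimately obtain j where j: "k = Suc j" "1 \<le> j" by (cases k) auto
  then have "\<not> \<alpha> \<le> real j + 2 / 2 ^ j"
    unfolding k_def by (intro not_less_Least) simp
  then show ?thesis using upper j by (intro exI[of _ k]) auto
qed

text \<open>With \<open>\<alpha> = 1/\<theta>\<close> and \<open>K = 2\<^sup>k\<close>, the number \<open>v = (k + 1 - \<alpha>) / (1 - 2/K)\<close> lies between 1 and 2,
  the two savings are \<open>\<theta> v / K\<close> and \<open>\<theta> (4 - v) / K\<close>, and \<open>2\<^bsup>1/K - \<alpha>\<^esup> \<le> 2\<^bsup>v - 1\<^esup> / K\<close>.\<close>

lemma hl_delta_le_saving:
  assumes "2 \<le> k" "0 < \<theta>" "real k - 1 + 4 / 2 ^ k \<le> 1 / \<theta>" "1 / \<theta> \<le> real k + 2 / 2 ^ k"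
  shows "hl_delta \<theta> * 2 powr (1 / 2 ^ k) \<le> hl_saving k \<theta>"
proof -
  define K :: real where "K = 2 ^ k"
  define \<alpha> where "\<alpha> = 1 / \<theta>"
  define v where "v = (real (Suc k) - \<alpha>) * K / (K - 2)"
  have "4 \<le> K" using four_le_two_power[OF assms(1)] by (simp add: K_def)
  have v: "1 \<le> v" "v \<le> 2"
    using assms(3,4) \<open>4 \<le> K\<close> unfolding \<alpha>_def[symmetric]
    by (auto simp: v_def K_def[symmetric] field_simps)
  have order_eq: "\<alpha> = real (Suc k) - v * (1 - 2 / K)"
    using \<open>4 \<le> K\<close> by (simp add: v_def field_simps)
  have "real (Suc k) * \<theta> - 1 = \<theta> * (real (Suc k) - \<alpha>)"
    using assms(2) by (simp add: \<alpha>_def field_simps)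
  then have saving: "(real (Suc k) * \<theta> - 1) * vdc_exp k = \<theta> * (v / K)"
    using \<open>4 \<le> K\<close> unfolding order_eq vdc_exp_def K_def[symmetric] by (simp add: field_simps)
  have "2 powr (1 / K - \<alpha>) \<le> 2 powr (v - 1 - real k)"
  proof (intro powr_mono)
    have "1 / K \<le> v * (2 / K)" using v \<open>4 \<le> K\<close> by (simp add: divide_right_mono)
    then show "1 / K - \<alpha> \<le> v - 1 - real k" unfolding order_eq by (simp add: algebra_simps)
  qed simp
  also have "\<dots> = (1 + 1) powr (v - 1) / K" by (simp add: K_def powr_diff powr_realpow)
  also have "\<dots> \<le> (1 + (v - 1) * 1) / K"
    using v \<open>4 \<le> K\<close> by (intro divide_right_mono powr_Bernoulli_le) auto
  finally have first_saving: "2 powr (1 / K - \<alpha>) \<le> v / K" by simp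
  also have "v / K \<le> 4 / K - v / K" using v \<open>4 \<le> K\<close> by (simp add: field_simps)
  finally have second_saving: "2 powr (1 / K - \<alpha>) \<le> 4 / K - v / K" .
  have "hl_delta \<theta> * 2 powr (1 / K) = \<theta> * 2 powr (1 / K - \<alpha>)"
    by (simp add: hl_delta_def \<alpha>_def powr_diff powr_minus_divide)
  also have "\<dots> \<le> hl_saving k \<theta>"
    unfolding hl_saving_def saving K_def[symmetric] min.bounded_iff
    using mult_left_mono[OF first_saving, of \<theta>] mult_left_mono[OF second_saving, of \<theta>] assms(2)
    by (simp add: right_diff_distrib)
  finally show ?thesis by (simp add: K_def)
qed

lemma hl_saving_2_ge:
  assumes "1 / 2 \<le> \<theta>" "\<theta> \<le> 2 / 3"
  shows "1 / 6 \<le> hl_saving 2 \<theta>"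
  using assms by (simp add: hl_saving_def vdc_exp_def field_simps)

lemma ex_saving_greater_hl_delta:
  assumes "0 < e" "e < 1 / 2"
  shows "\<exists>D>hl_delta e. \<exists>m. \<forall>\<theta>\<in>{e..2 / 3}. \<exists>k\<in>{2..m}. D \<le> hl_saving k \<theta>"
proof -
  define m where "m = nat \<lceil>1 / e\<rceil> + 2"
  define D where "D = hl_delta e * 2 powr (1 / 2 ^ m)"
  have "0 < hl_delta e" using assms by (simp add: hl_delta_def)
  moreover have "1 < (2::real) powr (1 / 2 ^ m)" by (simp add: gr_one_powr)
  ultimately have "hl_delta e < D" by (simp add: D_def)
  moreover have "\<exists>k\<in>{2..m}. D \<le> hl_saving k \<theta>" if \<theta>: "\<theta> \<in> {e..2 / 3}" for \<theta>
  proof (cases "1 / 2 \<le> \<theta>")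
    case True
    have "(1 + 1) powr (1 / 2 ^ m) \<le> 1 + 1 / 2 ^ m * (1::real)"
      by (rule powr_Bernoulli_le) auto
    also have "1 / 2 ^ m \<le> 1 / (2::real) ^ 2"
      by (intro divide_left_mono power_increasing) (simp_all add: m_def)
    finally have "D \<le> 1 / 8 * (5 / 4)"
      unfolding D_def using hl_delta_le[of e] assms by (intro mult_mono) auto
    also have "\<dots> \<le> hl_saving 2 \<theta>" using hl_saving_2_ge[OF True] \<theta> by simp
    finally show ?thesis by (intro bexI[of _ 2]) (auto simp: m_def)
  next
    case False
    then have "0 < \<theta>" "2 < 1 / \<theta>" using \<theta> assms by (auto simp: field_simps)
    then obtain k where k: "2 \<le> k" "real k - 1 + 4 / 2 ^ k \<le> 1 / \<theta>" "1 / \<theta> \<le> real k + 2 / 2 ^ k"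
      using ex_vdc_order by blast
    have "0 < 4 / (2::real) ^ k" by simp
    moreover have "1 / \<theta> \<le> 1 / e" using \<theta> assms by (intro divide_left_mono) auto
    ultimately have "k \<le> m" unfolding m_def using k(2) by linarith
    have "D \<le> hl_delta \<theta> * 2 powr (1 / 2 ^ k)"
      unfolding D_def using \<theta> assms \<open>0 < \<theta>\<close> \<open>k \<le> m\<close>
      by (intro mult_mono hl_delta_mono powr_mono divide_left_mono power_increasing)
        (auto simp: hl_delta_def)
    also have "\<dots> \<le> hl_saving k \<theta>" using hl_delta_le_saving[OF k(1) \<open>0 < \<theta>\<close> k(2,3)] .
    finally show ?thesis using k(1) \<open>k \<le> m\<close> by auto
  qed
  ultimately show ?thesis by blast
qed

section \<open>The middle range\<close>

definition hl_term :: "real \<Rightarrow> real \<Rightarrow> real" where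
  "hl_term x t = 1 / t * sin (x / t)"

lemma hl_block_bound:
  assumes "2 \<le> k" "0 < x" "1 \<le> N" "N' \<le> 2 * N"
  shows "\<bar>\<Sum>n=N..<N'. hl_term x (real n)\<bar>
    \<le> reciprocal_vdc_const k * (vdc_order_bound k (real N) (x / real N ^ Suc k) / real N)"
proof (cases "N < N'")
  case True
  let ?T = "reciprocal_vdc_const k * vdc_order_bound k (real N) (x / real N ^ Suc k)"
  have "(\<Sum>n=N..<N'. hl_term x (real n)) = Im (\<Sum>n=N..<N'. (1 / real n) *\<^sub>R cis (x / real n))"
    by (simp add: hl_term_def)
  also have "\<bar>\<dots>\<bar> \<le> norm (\<Sum>n=N..<N'. (1 / real n) *\<^sub>R cis (x / real n))"
    by (rule abs_Im_le_cmod)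
  also have "\<dots> \<le> 1 / real N * ?T"
  proof (rule abel_inequality[OF True])
    show "antimono_on {N..<N'} (\<lambda>n. 1 / real n)"
      using assms(3) by (auto simp: monotone_on_def intro!: divide_left_mono)
    show "norm (\<Sum>n=N..<k'. cis (x / real n)) \<le> ?T" if "k' \<in> {N..N'}" for k'
      using assms that by (intro norm_sum_cis_reciprocal_le) auto
  qed simp
  finally show ?thesis by simp
qed (simp add: reciprocal_vdc_const_nonneg vdc_bound_nonneg)

lemma hl_block_bound_powr:
  assumes "0 < e" "e < 1 / 2"
  shows "\<exists>D>hl_delta e. \<exists>A\<ge>0. \<forall>x\<ge>1. \<forall>N N'. x powr e \<le> real N \<longrightarrow> real N < x powr (2 / 3) \<longrightarrow>
    N' \<le> 2 * N \<longrightarrow> \<bar>\<Sum>n=N..<N'. hl_term x (real n)\<bar> \<le> A * x powr (- D)"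
proof -
  obtain D m where gain: "hl_delta e < D"
    and saving: "\<And>\<theta>. \<theta> \<in> {e..2 / 3} \<Longrightarrow> \<exists>k\<in>{2..m}. D \<le> hl_saving k \<theta>"
    using ex_saving_greater_hl_delta[OF assms] by blast
  define A where "A = 2 * (\<Sum>k\<in>{2..m}. reciprocal_vdc_const k)"
  have "\<bar>\<Sum>n=N..<N'. hl_term x (real n)\<bar> \<le> A * x powr (- D)"
    if "1 \<le> x" and N: "x powr e \<le> real N" "real N < x powr (2 / 3)" and "N' \<le> 2 * N"
    for x :: real and N N' :: nat
  proof -
    have "1 \<le> x powr e" using \<open>1 \<le> x\<close> assms by (simp add: ge_one_powr_ge_zero)
    then have "1 \<le> N" using N(1) by linarith
    have "x \<noteq> 1" using N by auto
    then have "1 < x" using \<open>1 \<le> x\<close> by simp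
    define \<theta> where "\<theta> = log x (real N)"
    have N_eq: "real N = x powr \<theta>" using \<open>1 < x\<close> \<open>1 \<le> N\<close> by (simp add: \<theta>_def)
    have "\<theta> \<in> {e..2 / 3}"
      using N \<open>1 < x\<close> unfolding N_eq by (simp add: powr_le_cancel_iff powr_less_cancel_iff)
    then obtain k where k: "k \<in> {2..m}" "D \<le> hl_saving k \<theta>" using saving by blast
    have "\<bar>\<Sum>n=N..<N'. hl_term x (real n)\<bar>
        \<le> reciprocal_vdc_const k * (vdc_order_bound k (real N) (x / real N ^ Suc k) / real N)"
      using k \<open>1 < x\<close> \<open>1 \<le> N\<close> \<open>N' \<le> 2 * N\<close> by (intro hl_block_bound) auto
    also have "\<dots> \<le> reciprocal_vdc_const k * (2 * x powr (- hl_saving k \<theta>))"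
      unfolding N_eq using \<open>1 \<le> x\<close>
      by (intro mult_left_mono vdc_bound_powr_le reciprocal_vdc_const_nonneg)
    also have "\<dots> \<le> (\<Sum>k\<in>{2..m}. reciprocal_vdc_const k) * (2 * x powr (- D))"
      using k \<open>1 \<le> x\<close>
      by (intro mult_mono member_le_sum powr_mono sum_nonneg)
        (auto simp: reciprocal_vdc_const_nonneg)
    finally show ?thesis by (simp add: A_def mult_ac)
  qed
  moreover have "0 \<le> A" by (simp add: A_def sum_nonneg reciprocal_vdc_const_nonneg)
  ultimately show ?thesis using gain by blast
qed

lemma norm_dyadic_sum_le:
  fixes c :: "nat \<Rightarrow> 'a::real_normed_vector"
  assumes "1 \<le> a" "a \<le> b" "0 \<le> T"
    and block: "\<And>N N'. a \<le> N \<Longrightarrow> N < b \<Longrightarrow> N' \<le> 2 * N \<Longrightarrow> norm (\<Sum>n=N..<N'. c n) \<le> T"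
  shows "norm (\<Sum>n=a..<b. c n) \<le> (log 2 (real b / real a) + 1) * T"
  using assms(1,2,4)
proof (induction "b - a" arbitrary: a rule: less_induct)
  case (less a)
  show ?case
  proof (cases "b \<le> 2 * a")
    case True
    have "norm (\<Sum>n=a..<b. c n) \<le> 1 * T"
      using less.prems True assms(3) by (cases "a = b") auto
    also have "\<dots> \<le> (log 2 (real b / real a) + 1) * T"
      using less.prems assms(3) by (intro mult_right_mono) auto
    finally show ?thesis .
  next
    case False
    have "norm (\<Sum>n=2 * a..<b. c n) \<le> (log 2 (real b / real (2 * a)) + 1) * T"
      using False less.prems by (intro less.hyps) auto
    also have "log 2 (real b / real (2 * a)) + 1 = log 2 (real b / real a)"
      using False less.prems by (simp add: log_divide log_mult)
    finally have "norm (\<Sum>n=2 * a..<b. c n) \<le> log 2 (real b / real a) * T" .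
    moreover have "norm (\<Sum>n=a..<2 * a. c n) \<le> T"
      using False less.prems by simp
    moreover have "(\<Sum>n=a..<b. c n) = (\<Sum>n=a..<2 * a. c n) + (\<Sum>n=2 * a..<b. c n)"
      using False by (simp add: sum.atLeastLessThan_concat)
    ultimately show ?thesis
      using norm_triangle_ineq[of "\<Sum>n=a..<2 * a. c n" "\<Sum>n=2 * a..<b. c n"]
      by (simp add: distrib_right)
  qed
qed

lemma log_le_powr:
  assumes "0 < c" "1 < b" "1 \<le> x"
  shows "log b x \<le> x powr c / (c * ln b)"
proof -
  have "ln x / ln b \<le> (x powr c / c) / ln b"
    using assms by (intro divide_right_mono ln_powr_bound) auto
  then show ?thesis by (simp add: log_def)
qed

lemma log_ratio_le_powr:
  fixes a b c x :: real
  assumes "0 < c" "1 \<le> a" "a \<le> b" "b \<le> 2 * x" "1 \<le> x"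
  shows "log 2 (b / a) + 1 \<le> (1 / (c * ln 2) + 2) * x powr c"
proof -
  have "b / a \<le> b / 1" using assms by (intro divide_left_mono) auto
  then have "log 2 (b / a) \<le> log 2 (2 * x)"
    using assms by (subst log_le_cancel_iff) auto
  also have "\<dots> = 1 + log 2 x" using assms by (simp add: log_mult)
  also have "log 2 x \<le> x powr c / (c * ln 2)"
    using assms by (intro log_le_powr) auto
  finally have "log 2 (b / a) + 1 \<le> x powr c / (c * ln 2) + 2 * 1" by simp
  also have "\<dots> \<le> x powr c / (c * ln 2) + 2 * x powr c"
    using assms by (intro add_left_mono mult_left_mono) (auto simp: ge_one_powr_ge_zero)
  finally show ?thesis by (simp add: algebra_simps)
qed

lemma middle_range_bound:
  assumes "0 < e" "e < 1 / 2"
  shows "\<exists>C\<ge>0. \<forall>x\<ge>1. \<bar>\<Sum>n=nat \<lceil>x powr e\<rceil>..<nat \<lceil>x powr (2 / 3)\<rceil>. hl_term x (real n)\<bar>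
    \<le> C * x powr (- hl_delta e)"
proof -
  obtain D A where gain: "hl_delta e < D" and "0 \<le> A"
    and block: "\<And>x N N'. 1 \<le> x \<Longrightarrow> x powr e \<le> real N \<Longrightarrow> real N < x powr (2 / 3) \<Longrightarrow> N' \<le> 2 * N \<Longrightarrow>
      \<bar>\<Sum>n=N..<N'. hl_term x (real n)\<bar> \<le> A * x powr (- D)"
    using hl_block_bound_powr[OF assms] by blast
  define c where "c = D - hl_delta e"
  have "0 < c" using gain by (simp add: c_def)
  define C where "C = (1 / (c * ln 2) + 2) * A"
  have "\<bar>\<Sum>n=nat \<lceil>x powr e\<rceil>..<nat \<lceil>x powr (2 / 3)\<rceil>. hl_term x (real n)\<bar> \<le> C * x powr (- hl_delta e)"
    if "1 \<le> x" for x
  proof -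
    define a b where "a = nat \<lceil>x powr e\<rceil>" and "b = nat \<lceil>x powr (2 / 3)\<rceil>"
    have powers: "1 \<le> x powr e" "x powr e \<le> x powr (2 / 3)"
      using \<open>1 \<le> x\<close> assms by (auto simp: ge_one_powr_ge_zero intro!: powr_mono)
    have "x powr (2 / 3) \<le> x"
      using \<open>1 \<le> x\<close> powr_mono[of "2 / 3" 1 x] by simp
    have "1 \<le> a" "a \<le> b"
      unfolding a_def b_def using powers by (linarith, intro nat_mono ceiling_mono)
    have "real b \<le> 2 * x" unfolding b_def using \<open>x powr (2 / 3) \<le> x\<close> \<open>1 \<le> x\<close> by linarith
    have "norm (\<Sum>n=a..<b. hl_term x (real n)) \<le> (log 2 (real b / real a) + 1) * (A * x powr (- D))"
    proof (rule norm_dyadic_sum_le[OF \<open>1 \<le> a\<close> \<open>a \<le> b\<close>])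
      show "0 \<le> A * x powr (- D)" using \<open>0 \<le> A\<close> by simp
      fix N N' assume "a \<le> N" "N < b" "N' \<le> 2 * N"
      moreover from this have "x powr e \<le> real N" "real N < x powr (2 / 3)"
        unfolding a_def b_def by linarith+
      ultimately show "norm (\<Sum>n=N..<N'. hl_term x (real n)) \<le> A * x powr (- D)"
        using \<open>1 \<le> x\<close> by (simp add: block)
    qed
    also have "\<dots> \<le> ((1 / (c * ln 2) + 2) * x powr c) * (A * x powr (- D))"
      using \<open>0 < c\<close> \<open>1 \<le> a\<close> \<open>a \<le> b\<close> \<open>real b \<le> 2 * x\<close> \<open>1 \<le> x\<close> \<open>0 \<le> A\<close>
      by (intro mult_right_mono log_ratio_le_powr) auto
    also have "\<dots> = C * (x powr c * x powr (- D))" by (simp add: C_def)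
    also have "x powr c * x powr (- D) = x powr (- hl_delta e)"
      by (simp add: c_def flip: powr_add)
    finally show ?thesis by (simp add: a_def b_def)
  qed
  moreover have "0 \<le> C" using \<open>0 \<le> A\<close> \<open>0 < c\<close> by (simp add: C_def)
  ultimately show ?thesis by blast
qed

section \<open>The tail\<close>

lemma tendsto_cos_add_divide_at_top:
  fixes s :: real
  shows "((\<lambda>t. (cos t + s) / t) \<longlongrightarrow> 0) at_top"
proof (rule Lim_null_comparison)
  show "\<forall>\<^sub>F t in at_top. norm ((cos t + s) / t) \<le> (1 + \<bar>s\<bar>) / t"
    using eventually_gt_at_top[of "0::real"]
  proof eventually_elim
    case (elim t)
    have "\<bar>cos t + s\<bar> \<le> 1 + \<bar>s\<bar>"
      by (intro order_trans[OF abs_triangle_ineq] add_right_mono) simp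
    then show ?case using elim by (simp add: divide_right_mono)
  qed
  show "((\<lambda>t. (1 + \<bar>s\<bar>) / t) \<longlongrightarrow> 0) at_top"
    by (intro tendsto_divide_0[OF tendsto_const] filterlim_at_top_imp_at_infinity filterlim_ident)
qed

lemma abs_Si_minus_half_pi_le:
  assumes "0 < y"
  shows "\<bar>Si y - pi / 2\<bar> \<le> 3 / y"
proof -
  define H where "H s t = Si t + (cos t + s) / t" for s t :: real
  have deriv: "(H s has_real_derivative - (cos t + s) / t\<^sup>2) (at t)" if "0 < t" for s t
    unfolding H_def using that
    by (auto intro!: derivative_eq_intros DERIV_Si simp: field_simps power2_eq_square)
  have lim: "(H s \<longlongrightarrow> pi / 2) at_top" for s
    using tendsto_add[OF Si_at_top tendsto_cos_add_divide_at_top[of s]] by (simp add: H_def[abs_def])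
  have "pi / 2 < H 2 y"
  proof (rule DERIV_neg_imp_decreasing_at_top[OF _ lim])
    fix t assume "y \<le> t"
    have "- 1 \<le> cos t" by simp
    then have "0 < cos t + 2" by linarith
    then show "\<exists>D. (H 2 has_real_derivative D) (at t) \<and> D < 0"
      using deriv[of t 2] assms \<open>y \<le> t\<close> by (intro exI conjI) (auto intro: divide_neg_pos)
  qed
  moreover have "- (pi / 2) < - H (- 2) y"
  proof (rule DERIV_neg_imp_decreasing_at_top[OF _ tendsto_minus[OF lim]])
    fix t assume "y \<le> t"
    have "cos t \<le> 1" by simp
    then have "cos t + - 2 < 0" by linarith
    then show "\<exists>D. ((\<lambda>t. - H (- 2) t) has_real_derivative D) (at t) \<and> D < 0"
      using DERIV_minus[OF deriv[of t "- 2"]] assms \<open>y \<le> t\<close>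
      by (intro exI conjI) (auto intro: divide_neg_pos)
  qed
  moreover have "(cos y + 2) / y \<le> 3 / y" "- (3 / y) \<le> (cos y + - 2) / y"
  proof -
    have "- 1 \<le> cos y" "cos y \<le> 1" by simp_all
    then have "cos y + 2 \<le> 3" "- 3 \<le> cos y + - 2" by linarith+
    then show "(cos y + 2) / y \<le> 3 / y" "- (3 / y) \<le> (cos y + - 2) / y"
      unfolding minus_divide_left using assms by (intro divide_right_mono; simp)+
  qed
  ultimately show ?thesis unfolding H_def by linarith
qed

lemma suminf_antiderivative_bound:
  fixes \<phi> G :: "real \<Rightarrow> real"
  assumes deriv: "\<And>t. a \<le> t \<Longrightarrow> (G has_real_derivative \<phi> t) (at t)"
    and lim: "(G \<longlongrightarrow> l) at_top"
    and variation: "\<And>n t. a + real n \<le> t \<Longrightarrow> t \<le> a + real n + 1 \<Longrightarrow> \<bar>\<phi> (a + real n) - \<phi> t\<bar> \<le> e n"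
    and "e sums E"
  shows "\<bar>(\<Sum>n. \<phi> (a + real n)) - (l - G a)\<bar> \<le> E"
proof -
  define g where "g n = G (a + real (Suc n)) - G (a + real n)" for n
  have "(\<lambda>n. G (a + real n)) \<longlonglongrightarrow> l"
    by (intro filterlim_compose[OF lim] filterlim_tendsto_add_at_top[OF tendsto_const]
        filterlim_real_sequentially)
  from telescope_sums[OF this] have "g sums (l - G a)" by (simp add: g_def[abs_def])
  have bound: "norm (\<phi> (a + real n) - g n) \<le> e n" for n
  proof -
    have "\<exists>t>a + real n. t < a + real n + 1 \<and>
        G (a + real n + 1) - G (a + real n) = (a + real n + 1 - (a + real n)) * \<phi> t"
      by (intro MVT2 deriv) auto
    then obtain t where "a + real n < t" "t < a + real n + 1" "g n = \<phi> t"
      by (auto simp: g_def add_ac)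
    then show ?thesis using variation[of n t] by simp
  qed
  then have diff: "summable (\<lambda>n. \<phi> (a + real n) - g n)"
    by (rule summable_comparison_test'[OF sums_summable[OF \<open>e sums E\<close>]])
  have "(\<lambda>n. (\<phi> (a + real n) - g n) + g n) sums ((\<Sum>n. \<phi> (a + real n) - g n) + (l - G a))"
    by (rule sums_add[OF summable_sums[OF diff] \<open>g sums (l - G a)\<close>])
  then have "(\<Sum>n. \<phi> (a + real n)) - (l - G a) = (\<Sum>n. \<phi> (a + real n) - g n)"
    by (simp add: sums_unique[symmetric])
  also have "norm \<dots> \<le> suminf e"
    by (rule norm_suminf_le[OF bound sums_summable[OF \<open>e sums E\<close>]])
  finally show ?thesis using sums_unique[OF \<open>e sums E\<close>] by simp
qed

lemma DERIV_hl_term: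
  assumes "0 < t"
  shows "(hl_term x has_real_derivative
    - (1 / t\<^sup>2) * sin (x / t) - 1 / t * (cos (x / t) * (x / t\<^sup>2))) (at t)"
  unfolding hl_term_def[abs_def] using assms
  by (auto intro!: derivative_eq_intros simp: field_simps power2_eq_square)

lemma hl_term_variation:
  assumes "0 \<le> x" "0 < s" "s \<le> t" "t \<le> s + 1"
  shows "\<bar>hl_term x s - hl_term x t\<bar> \<le> (x / s + 1) / s\<^sup>2"
proof (cases "s = t")
  case False
  define D where "D u = - (1 / u\<^sup>2) * sin (x / u) - 1 / u * (cos (x / u) * (x / u\<^sup>2))" for u
  have "(hl_term x has_real_derivative D u) (at u)" if "0 < u" for u
    unfolding D_def using that by (rule DERIV_hl_term)
  then have "\<exists>u>s. u < t \<and> hl_term x t - hl_term x s = (t - s) * D u"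
    using False assms by (intro MVT2) auto
  then obtain u where u: "s < u" "hl_term x t - hl_term x s = (t - s) * D u" by blast
  have "\<bar>D u\<bar> \<le> 1 / u\<^sup>2 * \<bar>sin (x / u)\<bar> + 1 / u * (\<bar>cos (x / u)\<bar> * (x / u\<^sup>2))"
    unfolding D_def using u assms
    by (intro order_trans[OF abs_triangle_ineq4]) (simp add: abs_mult)
  also have "\<dots> \<le> 1 / u\<^sup>2 * 1 + 1 / u * (1 * (x / u\<^sup>2))"
    using u assms by (intro add_mono mult_left_mono mult_right_mono) auto
  also have "\<dots> = (x / u + 1) / u\<^sup>2" using u assms by (simp add: field_simps)
  also have "\<dots> \<le> (x / s + 1) / s\<^sup>2"
    using u assms by (intro frac_le add_mono divide_left_mono power_mono) auto
  finally have "(t - s) * \<bar>D u\<bar> \<le> 1 * ((x / s + 1) / s\<^sup>2)"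
    using assms by (intro mult_mono) auto
  then show ?thesis using u assms by (simp add: abs_mult abs_minus_commute[of "hl_term x s"])
qed (use assms in simp)

lemma sums_inverse_telescope:
  fixes a :: real
  shows "(\<lambda>n. 1 / (a + real n) - 1 / (a + real (Suc n))) sums (1 / a)"
proof -
  have "(\<lambda>n. 1 / (a + real n)) \<longlonglongrightarrow> 0"
    by (intro tendsto_divide_0[OF tendsto_const] filterlim_at_top_imp_at_infinity
        filterlim_tendsto_add_at_top[OF tendsto_const filterlim_real_sequentially])
  from telescope_sums'[OF this] show ?thesis by simp
qed

lemma inverse_square_le_telescope:
  fixes s :: real
  assumes "1 \<le> s"
  shows "1 / (2 * s\<^sup>2) \<le> 1 / s - 1 / (s + 1)"
proof -
  have "s * 1 \<le> s * s" using assms by (intro mult_left_mono) auto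
  then have "s * (s + 1) \<le> 2 * s\<^sup>2" by (simp add: power2_eq_square algebra_simps)
  then have "1 / (2 * s\<^sup>2) \<le> 1 / (s * (s + 1))"
    using assms by (intro divide_left_mono mult_pos_pos) auto
  also have "\<dots> = 1 / s - 1 / (s + 1)" using assms by (simp add: field_simps)
  finally show ?thesis .
qed

lemma DERIV_minus_Si_divide:
  assumes "0 < x" "0 < t"
  shows "((\<lambda>t. - Si (x / t)) has_real_derivative hl_term x t) (at t)"
proof -
  have "((\<lambda>t. - Si (x / t)) has_real_derivative - (sin (x / t) / (x / t) * (- x / t\<^sup>2))) (at t)"
    using assms
    by (auto intro!: derivative_eq_intros DERIV_chain2[OF DERIV_Si] simp: power2_eq_square)
  then show ?thesis using assms by (simp add: hl_term_def power2_eq_square)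
qed

lemma hl_tail_bound:
  assumes "0 < x" "1 \<le> a"
  shows "\<bar>(\<Sum>n. hl_term x (a + real n)) - pi / 2\<bar> \<le> 2 * x / a\<^sup>2 + 2 / a + 3 * a / x"
proof -
  define K where "K = 2 * (x / a + 1)"
  have "((\<lambda>t. - Si (x / t)) \<longlongrightarrow> - Si 0) at_top"
    by (intro tendsto_minus isCont_tendsto_compose[OF isCont_Si] tendsto_divide_0[OF tendsto_const]
        filterlim_at_top_imp_at_infinity filterlim_ident)
  moreover have "Si 0 = 0" by (simp add: Si_def zero_ereal_def)
  ultimately have lim: "((\<lambda>t. - Si (x / t)) \<longlongrightarrow> 0) at_top" by simp
  have "\<bar>(\<Sum>n. hl_term x (a + real n)) - (0 - - Si (x / a))\<bar> \<le> K * (1 / a)"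
  proof (rule suminf_antiderivative_bound[OF _ lim])
    show "((\<lambda>t. - Si (x / t)) has_real_derivative hl_term x t) (at t)" if "a \<le> t" for t
      using assms that by (intro DERIV_minus_Si_divide) auto
    show "(\<lambda>n. K * (1 / (a + real n) - 1 / (a + real (Suc n)))) sums (K * (1 / a))"
      by (intro sums_mult sums_inverse_telescope)
    fix n t assume t: "a + real n \<le> t" "t \<le> a + real n + 1"
    define s where "s = a + real n"
    have s: "a \<le> s" "1 \<le> s" using assms by (auto simp: s_def)
    have "\<bar>hl_term x s - hl_term x t\<bar> \<le> (x / s + 1) / s\<^sup>2"
      using t assms by (intro hl_term_variation) (auto simp: s_def)
    also have "\<dots> \<le> (x / a + 1) / s\<^sup>2"
      using s assms by (intro divide_right_mono add_right_mono divide_left_mono) auto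
    also have "\<dots> = K * (1 / (2 * s\<^sup>2))" by (simp add: K_def add_divide_distrib)
    also have "\<dots> \<le> K * (1 / s - 1 / (s + 1))"
      using s assms by (intro mult_left_mono inverse_square_le_telescope) (auto simp: K_def)
    finally show "\<bar>hl_term x (a + real n) - hl_term x t\<bar>
        \<le> K * (1 / (a + real n) - 1 / (a + real (Suc n)))"
      by (simp add: s_def add_ac)
  qed
  moreover have "K * (1 / a) = 2 * x / a\<^sup>2 + 2 / a"
    using assms by (simp add: K_def field_simps power2_eq_square)
  moreover have "\<bar>Si (x / a) - pi / 2\<bar> \<le> 3 * a / x"
    using abs_Si_minus_half_pi_le[of "x / a"] assms by simp
  ultimately show ?thesis by simp
qed

lemma hl_tail_bound_powr:
  assumes "1 \<le> x"
  shows "\<bar>(\<Sum>n. hl_term x (real (nat \<lceil>x powr (2 / 3)\<rceil>) + real n)) - pi / 2\<bar> \<le> 10 * x powr (- 1 / 3)"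
proof -
  define y where "y = x powr (1 / 3)"
  define a where "a = real (nat \<lceil>x powr (2 / 3)\<rceil>)"
  have "1 \<le> y" using assms by (simp add: y_def ge_one_powr_ge_zero)
  have x_eq: "x = y ^ 3" and square: "x powr (2 / 3) = y\<^sup>2" and reciprocal: "x powr (- 1 / 3) = 1 / y"
    using assms by (simp_all add: y_def powr_minus_divide powr_powr flip: powr_realpow)
  have "1 \<le> y\<^sup>2" using \<open>1 \<le> y\<close> by simp
  then have a: "y\<^sup>2 \<le> a" "a \<le> 2 * y\<^sup>2" unfolding a_def square by linarith+
  have "\<bar>(\<Sum>n. hl_term x (a + real n)) - pi / 2\<bar> \<le> 2 * x / a\<^sup>2 + 2 / a + 3 * a / x"
    using assms a \<open>1 \<le> y\<^sup>2\<close> by (intro hl_tail_bound) auto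
  also have "\<dots> \<le> 2 * x / (y\<^sup>2)\<^sup>2 + 2 / y\<^sup>2 + 3 * (2 * y\<^sup>2) / x"
    using assms a \<open>1 \<le> y\<^sup>2\<close>
    by (intro add_mono divide_left_mono divide_right_mono mult_left_mono power_mono mult_pos_pos) auto
  also have "\<dots> = 8 / y + 2 / y\<^sup>2"
    unfolding x_eq using \<open>1 \<le> y\<close> by (simp add: field_simps power2_eq_square power3_eq_cube)
  also have "2 / y\<^sup>2 \<le> 2 / y"
    using \<open>1 \<le> y\<close> by (intro divide_left_mono) (auto simp: power2_eq_square)
  also have "8 / y + 2 / y = 10 * x powr (- 1 / 3)" unfolding reciprocal by simp
  finally show ?thesis by (simp add: a_def)
qed

section \<open>The asymptotic formula\<close>

lemma hardy_littlewood_Q_split: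
  assumes "1 \<le> a" "a \<le> b"
  shows "hardy_littlewood_Q x = (\<Sum>n=1..<a. hl_term x (real n)) + (\<Sum>n=a..<b. hl_term x (real n))
    + (\<Sum>n. hl_term x (real b + real n))"
proof -
  obtain c where b: "b = Suc c" using assms by (cases b) auto
  have "hardy_littlewood_Q x = (\<Sum>n. hl_term x (real (Suc n)))"
    by (simp add: hardy_littlewood_Q_def hl_term_def)
  also have "\<dots> = (\<Sum>n. hl_term x (real (Suc (n + c)))) + (\<Sum>n<c. hl_term x (real (Suc n)))"
    using suminf_split_initial_segment[OF summable_hardy_littlewood_Q[of x], of c]
    by (simp add: hl_term_def)
  also have "(\<Sum>n<c. hl_term x (real (Suc n))) = (\<Sum>n=1..<b. hl_term x (real n))"
    unfolding b by (rule sum.reindex_bij_witness[where i = "\<lambda>n. n - 1" and j = Suc]) auto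
  also have "\<dots> = (\<Sum>n=1..<a. hl_term x (real n)) + (\<Sum>n=a..<b. hl_term x (real n))"
    using assms by (simp add: sum.atLeastLessThan_concat)
  finally show ?thesis by (simp add: b add_ac)
qed

lemma hardy_littlewood_Q_cutoffs:
  assumes "1 \<le> y" "y \<le> z"
  shows "hardy_littlewood_Q x = (\<Sum>n | 1 \<le> n \<and> real n < y. 1 / real n * sin (x / real n))
    + (\<Sum>n=nat \<lceil>y\<rceil>..<nat \<lceil>z\<rceil>. hl_term x (real n))
    + (\<Sum>n. hl_term x (real (nat \<lceil>z\<rceil>) + real n))"
proof -
  have "1 \<le> nat \<lceil>y\<rceil>" "nat \<lceil>y\<rceil> \<le> nat \<lceil>z\<rceil>"
    using assms by (linarith, intro nat_mono ceiling_mono)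
  moreover have "{n. 1 \<le> n \<and> real n < y} = {1..<nat \<lceil>y\<rceil>}"
    by auto linarith+
  ultimately show ?thesis
    using hardy_littlewood_Q_split[of "nat \<lceil>y\<rceil>" "nat \<lceil>z\<rceil>" x] by (simp only: hl_term_def)
qed

theorem theorem3:
  fixes \<epsilon> :: real
  assumes "0 < \<epsilon>" and "\<epsilon> < 1 / 2"
  shows "\<exists>C>0. \<forall>x::real. x \<ge> 1 \<longrightarrow>
    \<bar>hardy_littlewood_Q x
      - (\<Sum>n | 1 \<le> n \<and> real n < x powr \<epsilon>. 1 / real n * sin (x / real n))
      - pi / 2\<bar> \<le> C * x powr (- hl_delta \<epsilon>)"
proof -
  obtain C where "0 \<le> C" and middle: "\<And>x. 1 \<le> x \<Longrightarrow>
      \<bar>\<Sum>n=nat \<lceil>x powr \<epsilon>\<rceil>..<nat \<lceil>x powr (2 / 3)\<rceil>. hl_term x (real n)\<bar> \<le> C * x powr (- hl_delta \<epsilon>)"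
    using middle_range_bound[OF assms] by blast
  have "\<bar>hardy_littlewood_Q x
      - (\<Sum>n | 1 \<le> n \<and> real n < x powr \<epsilon>. 1 / real n * sin (x / real n))
      - pi / 2\<bar> \<le> (C + 10) * x powr (- hl_delta \<epsilon>)" if "1 \<le> x" for x
  proof -
    have "1 \<le> x powr \<epsilon>" "x powr \<epsilon> \<le> x powr (2 / 3)"
      using \<open>1 \<le> x\<close> assms by (auto simp: ge_one_powr_ge_zero intro!: powr_mono)
    note hardy_littlewood_Q_cutoffs[OF this, of x]
    moreover have "x powr (- 1 / 3) \<le> x powr (- hl_delta \<epsilon>)"
      using hl_delta_le[of \<epsilon>] assms \<open>1 \<le> x\<close> by (intro powr_mono) auto
    ultimately show ?thesis
      using middle[OF \<open>1 \<le> x\<close>] hl_tail_bound_powr[OF \<open>1 \<le> x\<close>]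
      unfolding distrib_right by linarith
  qed
  then show ?thesis using \<open>0 \<le> C\<close> by (intro exI[of _ "C + 10"]) simp
qed

end
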